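(* In the setting and under the assumptions stated in the context, there exists a constant $M_0=M_0(H,\|Dg\|_{L^\infty(\mathbb{R}^n)})>0$ (independent of $\varepsilon,t,x$) with the following property. Let $\varepsilon,t>0$, $x\in\overline\Omega_\varepsilon$, and let $u^\varepsilon$ be the viscosity solution of the Dirichlet problem $$u^\varepsilon_t+H\left(\tfrac{x}{\varepsilon},Du^\varepsilon\right)=0\ \text{in }\Omega_\varepsilon\times(0,\infty),\quad u^\varepsilon=b\left(x,\tfrac{x}{\varepsilon}\right)\ \text{on }\partial\Omega_\varepsilon\times(0,\infty),\quad u^\varepsilon(\cdot,0)=g\ \text{on }\overline\Omega_\varepsilon.$$ Suppose that for some $\tau\in[0,t)$ the absolutely continuous curve $\gamma:[\tfrac{\tau}{\varepsilon},\tfrac{t}{\varepsilon}]\to\overline\Omega$ is minimizing for $u^\varepsilon(x,t)$, i.e. $$u^\varepsilon(x,t)=\varepsilon\int_{\tau/\varepsilon}^{t/\varepsilon}L(\gamma(s),\dot\gamma(s))\,ds+f_\varepsilon\left(\varepsilon\gamma\left(\tfrac{\tau}{\varepsilon}\right),\tau\right),\qquad\gamma\left(\tfrac{t}{\varepsilon}\right)=\tfrac{x}{\varepsilon},\qquad\left(\gamma\left(\tfrac{\tau}{\varepsilon}\right),\tau\right)\in\partial Q_t.$$ Then $$|\dot\gamma(s)|\le M_0\qquad\text{for a.e. }s\in\left[\tfrac{\tau}{\varepsilon},\tfrac{t}{\varepsilon}\right].$$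
   Context: $n\ge2$; $\Omega\subset\mathbb{R}^n$ is open, connected, $\mathbb{Z}^n$-periodic ($\Omega+\mathbb{Z}^n=\Omega$), with nonempty $C^1$ boundary; $\Omega_\varepsilon=\varepsilon\Omega$. Assumptions: (1) $H\in C(\mathbb{R}^n\times\mathbb{R}^n)$, $\mathbb{Z}^n$-periodic in the first variable; (2) $\lim_{|p|\to\infty}\inf_yH(y,p)=+\infty$; (3) $p\mapsto H(y,p)$ convex for each $y$; (4) $b\in\mathrm{BUC}(\mathbb{R}^n\times\partial\Omega)$ and $b(x,y+z)=b(x,y)$ for $z\in\mathbb{Z}^n$; (5) $g\in\mathrm{BUC}(\mathbb{R}^n)\cap\mathrm{Lip}(\mathbb{R}^n)$ and $g\le\overline b$ on $\mathbb{R}^n$, where $\overline b(x)=\min_{z\in\partial\Omega}b(x,z)$. ($\mathrm{BUC}$ = bounded uniformly continuous.) Standing normalization: there is $K_0>0$, depending only on $H$ and $\|Dg\|_{L^\infty}$, with $\frac{|p|^2}{2}-K_0\le H(y,p)\le\frac{|p|^2}{2}+K_0$ for all $(y,p)$. $L(y,v)=\sup_p(p\cdot v-H(y,p))$, so $\frac{|v|^2}{2}-K_0\le L(y,v)\le\frac{|v|^2}{2}+K_0$. Notation: $\partial Q_t=(\partial\Omega\times(0,t))\cup(\overline\Omega\times\{0\})$. $f_\varepsilon(x,0)=g(x)$ for $x\in\overline\Omega_\varepsilon$, and $f_\varepsilon(x,t)=b(x,\tfrac{x}{\varepsilon})$ for $x\in\partial\Omega_\varepsilon$, $t>0$. The Dirichlet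 condition is in the generalized viscosity sense: on $\partial\Omega_\varepsilon\times(0,\infty)$, with test functions touching relative to $\overline\Omega_\varepsilon\times(0,\infty)$, $\min\{u_t+H(\tfrac{x}{\varepsilon},Du),u-b(x,\tfrac{x}{\varepsilon})\}\le0$ (subsolution) and $\max\{u_t+H(\tfrac{x}{\varepsilon},Du),u-b(x,\tfrac{x}{\varepsilon})\}\ge0$ (supersolution). The problem is taken to be well-posed, $u^\varepsilon$ being its unique (uniformly continuous) viscosity solution. *)

theory Defs
  imports "HOL-Analysis.Analysis" "HOL-Probability.Essential_Supremum"
begin

definition integer_lattice :: "(real^'n) set" where
  "integer_lattice = {z. \<forall>i. z $ i \<in> \<int>}"

definition C1_with_gradient :: "('a::real_inner \<Rightarrow> real) \<Rightarrow> ('a \<Rightarrow> 'a) \<Rightarrow> bool" where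
  "C1_with_gradient f Df \<longleftrightarrow> (\<forall>x. GDERIV f x :> Df x) \<and> continuous_on UNIV Df"

(* Near each boundary point the set is, in suitable orthonormal coordinates, the strict epigraph
   of a C^1 function of n - 1 variables. The vertical direction is the unit vector nu, and the
   n - 1 horizontal variables are the orthogonal projection onto its orthogonal complement. *)
definition C1_boundary :: "(real^'n) set \<Rightarrow> bool" where
  "C1_boundary \<Omega> \<longleftrightarrow>
     (\<forall>x0\<in>frontier \<Omega>. \<exists>r>0. \<exists>\<nu> \<psi> D\<psi>. norm \<nu> = 1 \<and> C1_with_gradient \<psi> D\<psi> \<and>
        \<Omega> \<inter> ball x0 r = {y \<in> ball x0 r. y \<bullet> \<nu> > \<psi> (y - (y \<bullet> \<nu>) *\<^sub>R \<nu>)})"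

definition periodic_C1_domain :: "(real^'n) set \<Rightarrow> bool" where
  "periodic_C1_domain \<Omega> \<longleftrightarrow>
     open \<Omega> \<and> connected \<Omega> \<and>
     {y + z | y z. y \<in> \<Omega> \<and> z \<in> integer_lattice} = \<Omega> \<and>
     frontier \<Omega> \<noteq> {} \<and> C1_boundary \<Omega>"

definition scaled_domain :: "(real^'n) set \<Rightarrow> real \<Rightarrow> (real^'n) set" where
  "scaled_domain \<Omega> \<epsilon> = (\<lambda>y. \<epsilon> *\<^sub>R y) ` \<Omega>"

(* The last conjunct is the standing normalization of H. *)
definition admissible_hamiltonian :: "(real^'n \<Rightarrow> real^'n \<Rightarrow> real) \<Rightarrow> bool" where
  "admissible_hamiltonian H \<longleftrightarrow>
     continuous_on UNIV (\<lambda>(y, p). H y p) \<and>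
     (\<forall>y p. \<forall>z\<in>integer_lattice. H (y + z) p = H y p) \<and>
     filterlim (\<lambda>p. INF y. H y p) at_top at_infinity \<and>
     (\<forall>y. convex_on UNIV (H y)) \<and>
     (\<exists>K0>0. \<forall>y p. (norm p)\<^sup>2 / 2 - K0 \<le> H y p \<and> H y p \<le> (norm p)\<^sup>2 / 2 + K0)"

definition lagrangian :: "(real^'n \<Rightarrow> real^'n \<Rightarrow> real) \<Rightarrow> real^'n \<Rightarrow> real^'n \<Rightarrow> real" where
  "lagrangian H y v = (SUP p. p \<bullet> v - H y p)"

definition BUC_on :: "'a::metric_space set \<Rightarrow> ('a \<Rightarrow> real) \<Rightarrow> bool" where
  "BUC_on S f \<longleftrightarrow> bounded (f ` S) \<and> uniformly_continuous_on S f"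

definition admissible_bdry_data ::
    "(real^'n) set \<Rightarrow> (real^'n \<Rightarrow> real^'n \<Rightarrow> real) \<Rightarrow> bool" where
  "admissible_bdry_data \<Omega> b \<longleftrightarrow>
     BUC_on (UNIV \<times> frontier \<Omega>) (\<lambda>(x, y). b x y) \<and>
     (\<forall>x. \<forall>y\<in>frontier \<Omega>. \<forall>z\<in>integer_lattice. b x (y + z) = b x y)"

(* The infimum is attained, because b x is continuous and periodic on the frontier. *)
definition bdry_data_min :: "(real^'n) set \<Rightarrow> (real^'n \<Rightarrow> real^'n \<Rightarrow> real) \<Rightarrow> real^'n \<Rightarrow> real" where
  "bdry_data_min \<Omega> b x = (INF z\<in>frontier \<Omega>. b x z)"

definition admissible_initial_data ::
    "(real^'n) set \<Rightarrow> (real^'n \<Rightarrow> real^'n \<Rightarrow> real) \<Rightarrow> (real^'n \<Rightarrow> real) \<Rightarrow> bool" where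
  "admissible_initial_data \<Omega> b g \<longleftrightarrow>
     BUC_on UNIV g \<and> (\<exists>C. C-lipschitz_on UNIV g) \<and> (\<forall>x. g x \<le> bdry_data_min \<Omega> b x)"

(* The L^infinity norm of the gradient of g equals G. For Lipschitz g an almost-everywhere
   gradient Dg always exists (Rademacher), and it is unique up to null sets. *)
definition gradient_Linfty_norm :: "(real^'n \<Rightarrow> real) \<Rightarrow> real \<Rightarrow> bool" where
  "gradient_Linfty_norm g G \<longleftrightarrow>
     (\<exists>Dg. (AE x in lebesgue. GDERIV g x :> Dg x) \<and>
           esssup lebesgue (\<lambda>x. ereal (norm (Dg x))) = ereal G)"

definition bdry_initial_data ::
    "(real^'n \<Rightarrow> real^'n \<Rightarrow> real) \<Rightarrow> (real^'n \<Rightarrow> real) \<Rightarrow> real \<Rightarrow> real^'n \<Rightarrow> real \<Rightarrow> real" where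
  "bdry_initial_data b g \<epsilon> x t = (if t = 0 then g x else b x (x /\<^sub>R \<epsilon>))"

definition parabolic_bdry :: "(real^'n) set \<Rightarrow> real \<Rightarrow> ((real^'n) \<times> real) set" where
  "parabolic_bdry \<Omega> t = frontier \<Omega> \<times> {0<..<t} \<union> closure \<Omega> \<times> {0}"

(* Test functions touch u relative to closure W x (0, infinity), both at interior and at lateral
   boundary points; the gradient of the test function is split as (D phi, phi_t). *)
definition viscosity_subsolution ::
    "(real^'n \<Rightarrow> real^'n \<Rightarrow> real) \<Rightarrow> (real^'n \<Rightarrow> real^'n \<Rightarrow> real) \<Rightarrow> (real^'n) set \<Rightarrow> real \<Rightarrow>
     (real^'n \<Rightarrow> real \<Rightarrow> real) \<Rightarrow> bool" where
  "viscosity_subsolution H b \<Omega> \<epsilon> u \<longleftrightarrow>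
     (let W = scaled_domain \<Omega> \<epsilon> in
      \<forall>x\<in>closure W. \<forall>t>0. \<forall>\<phi> D\<phi> p q.
        C1_with_gradient \<phi> D\<phi> \<and> D\<phi> (x, t) = (p, q) \<and>
        (\<forall>\<^sub>F (y, s) in at (x, t) within closure W \<times> {0<..}.
            u y s - \<phi> (y, s) \<le> u x t - \<phi> (x, t)) \<longrightarrow>
        (x \<in> W \<longrightarrow> q + H (x /\<^sub>R \<epsilon>) p \<le> 0) \<and>
        (x \<in> frontier W \<longrightarrow> min (q + H (x /\<^sub>R \<epsilon>) p) (u x t - b x (x /\<^sub>R \<epsilon>)) \<le> 0))"

definition viscosity_supersolution ::
    "(real^'n \<Rightarrow> real^'n \<Rightarrow> real) \<Rightarrow> (real^'n \<Rightarrow> real^'n \<Rightarrow> real) \<Rightarrow> (real^'n) set \<Rightarrow> real \<Rightarrow>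
     (real^'n \<Rightarrow> real \<Rightarrow> real) \<Rightarrow> bool" where
  "viscosity_supersolution H b \<Omega> \<epsilon> u \<longleftrightarrow>
     (let W = scaled_domain \<Omega> \<epsilon> in
      \<forall>x\<in>closure W. \<forall>t>0. \<forall>\<phi> D\<phi> p q.
        C1_with_gradient \<phi> D\<phi> \<and> D\<phi> (x, t) = (p, q) \<and>
        (\<forall>\<^sub>F (y, s) in at (x, t) within closure W \<times> {0<..}.
            u y s - \<phi> (y, s) \<ge> u x t - \<phi> (x, t)) \<longrightarrow>
        (x \<in> W \<longrightarrow> q + H (x /\<^sub>R \<epsilon>) p \<ge> 0) \<and>
        (x \<in> frontier W \<longrightarrow> max (q + H (x /\<^sub>R \<epsilon>) p) (u x t - b x (x /\<^sub>R \<epsilon>)) \<ge> 0))"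

definition dirichlet_viscosity_solution ::
    "(real^'n \<Rightarrow> real^'n \<Rightarrow> real) \<Rightarrow> (real^'n \<Rightarrow> real^'n \<Rightarrow> real) \<Rightarrow> (real^'n \<Rightarrow> real) \<Rightarrow>
     (real^'n) set \<Rightarrow> real \<Rightarrow> (real^'n \<Rightarrow> real \<Rightarrow> real) \<Rightarrow> bool" where
  "dirichlet_viscosity_solution H b g \<Omega> \<epsilon> u \<longleftrightarrow>
     uniformly_continuous_on (closure (scaled_domain \<Omega> \<epsilon>) \<times> {0..}) (\<lambda>(x, t). u x t) \<and>
     viscosity_subsolution H b \<Omega> \<epsilon> u \<and>
     viscosity_supersolution H b \<Omega> \<epsilon> u \<and>
     (\<forall>x\<in>closure (scaled_domain \<Omega> \<epsilon>). u x 0 = g x)"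

definition the_dirichlet_viscosity_solution ::
    "(real^'n \<Rightarrow> real^'n \<Rightarrow> real) \<Rightarrow> (real^'n \<Rightarrow> real^'n \<Rightarrow> real) \<Rightarrow> (real^'n \<Rightarrow> real) \<Rightarrow>
     (real^'n) set \<Rightarrow> real \<Rightarrow> (real^'n \<Rightarrow> real \<Rightarrow> real) \<Rightarrow> bool" where
  "the_dirichlet_viscosity_solution H b g \<Omega> \<epsilon> u \<longleftrightarrow>
     dirichlet_viscosity_solution H b g \<Omega> \<epsilon> u \<and>
     (\<forall>w. dirichlet_viscosity_solution H b g \<Omega> \<epsilon> w \<longrightarrow>
          (\<forall>x\<in>closure (scaled_domain \<Omega> \<epsilon>). \<forall>t\<ge>0. w x t = u x t))"

(* D ranges over the finite families of non-overlapping compact intervals contained in S. *)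
definition AC_on :: "real set \<Rightarrow> (real \<Rightarrow> 'a::real_normed_vector) \<Rightarrow> bool" where
  "AC_on S f \<longleftrightarrow>
     (\<forall>e>0. \<exists>d>0. \<forall>D. D division_of \<Union>D \<and> \<Union>D \<subseteq> S \<and> (\<Sum>k\<in>D. Sup k - Inf k) < d \<longrightarrow>
        (\<Sum>k\<in>D. norm (f (Sup k) - f (Inf k))) < e)"

(* d\<gamma> is the almost-everywhere derivative of \<gamma>, which exists by absolute continuity.
   Integrability of the running cost has to be required explicitly, since the Lebesgue integral
   of a non-integrable function is 0 by convention. It is part of the informal condition: the
   running cost is bounded below, and its integral equals a real number. *)
definition minimizing_curve ::
    "(real^'n \<Rightarrow> real^'n \<Rightarrow> real) \<Rightarrow> (real^'n \<Rightarrow> real^'n \<Rightarrow> real) \<Rightarrow> (real^'n \<Rightarrow> real) \<Rightarrow>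
     (real^'n) set \<Rightarrow> real \<Rightarrow> (real^'n \<Rightarrow> real \<Rightarrow> real) \<Rightarrow> real^'n \<Rightarrow> real \<Rightarrow> real \<Rightarrow>
     (real \<Rightarrow> real^'n) \<Rightarrow> (real \<Rightarrow> real^'n) \<Rightarrow> bool" where
  "minimizing_curve H b g \<Omega> \<epsilon> u x t \<tau> \<gamma> d\<gamma> \<longleftrightarrow>
     (let I = {\<tau> / \<epsilon> .. t / \<epsilon>} in
      (\<forall>s\<in>I. \<gamma> s \<in> closure \<Omega>) \<and> AC_on I \<gamma> \<and>
      (AE s in lebesgue. s \<in> I \<longrightarrow> (\<gamma> has_vector_derivative d\<gamma> s) (at s within I)) \<and>
      set_integrable lebesgue I (\<lambda>s. lagrangian H (\<gamma> s) (d\<gamma> s)) \<and>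
      u x t = \<epsilon> * (LINT s:I|lebesgue. lagrangian H (\<gamma> s) (d\<gamma> s))
              + bdry_initial_data b g \<epsilon> (\<epsilon> *\<^sub>R \<gamma> (\<tau> / \<epsilon>)) \<tau> \<and>
      \<gamma> (t / \<epsilon>) = x /\<^sub>R \<epsilon> \<and>
      (\<gamma> (\<tau> / \<epsilon>), \<tau>) \<in> parabolic_bdry \<Omega> t)"

end

theory Submission
  imports Defs
begin

text \<open>
  Let \<open>X\<close> be the minimizer in the macroscopic variables, and write \<open>E\<close> for the integral of
  \<open>\<bar>X'\<bar>\<^sup>2\<close> over an interval \<open>[r, r + k]\<close> of small length \<open>k\<close>. A subsolution increases along any curve
  in the closed domain by at most the running cost of that curve, and coercivity of \<open>H\<close> makes it
  lie below \<open>b\<close> on the lateral boundary. Hence equality holds along \<open>X\<close>: the increment of \<open>u\<close> over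
  \<open>[r, r + k]\<close> is at least \<open>E / 2 - K k\<close>. On the other hand, shifting \<open>X\<close> back in time shows
  \<open>u (X r) (r - k) \<le> u (X r) r + C k\<close> with \<open>C = G\<^sup>2 / 2 + K\<close>, and traversing the piece
  of \<open>X\<close> at half the speed, starting at time \<open>r - k\<close>, costs at most \<open>E / 4 + 2 K k\<close>.
  Together, \<open>E \<le> (16 K + 2 G\<^sup>2) k\<close>, which bounds the speed by \<open>sqrt (16 K + 2 G\<^sup>2)\<close>.
\<close>

section \<open>Absolutely continuous curves\<close>

text \<open>The delicate point is the increment inequality on the closed domain: \<open>u\<close> is
  only continuous, \<open>h\<close> has no spatial modulus uniform in the momentum, and the curve
  may run along the boundary. Short pieces are therefore translated into the open domain in one
  fixed direction, which leaves their velocity unchanged, and the error is charged to the kinetic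
  energy. The backward shift is forced by the half-speed competitor, which needs time
  \<open>2 * k\<close> for what \<open>X\<close> covers in time \<open>k\<close>. If
  \<open>0 < \<tau>\<close>, the shifted curve leaves the same lateral point at time
  \<open>\<tau> - k\<close>, where \<open>u\<close> is below \<open>b\<close>, and \<open>b\<close>
  does not depend on time. If \<open>\<tau> = 0\<close>, the shift would begin before time zero; the
  curve starts at \<open>X k\<close> instead, and \<open>G\<close> enters through the Lipschitz
  bound on \<open>g\<close>. Young's inequality absorbs the displacement from \<open>X 0\<close> to
  \<open>X k\<close> into the energy of the omitted piece and leaves the term with \<open>G\<close>
  in \<open>C\<close>. Macroscopic variables preserve velocities and the growth constant
  \<open>K\<close>, so the bound does not see \<open>\<epsilon>\<close>.\<close>

lemma AC_on_subset: "AC_on S f \<Longrightarrow> T \<subseteq> S \<Longrightarrow> AC_on T f"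
  unfolding AC_on_def by (meson order_trans)

text \<open>Fundamental theorem of calculus by a direct choice of gauge. Off \<open>N\<close> the
  derivative controls each tagged interval up to \<open>e'\<close> times its length. On
  \<open>N\<close> the integrand is set to 0, and the increments are small by absolute continuity,
  because the gauge confines these intervals to an open set of small measure.\<close>

lemma AC_on_has_integral:
  fixes f :: "real \<Rightarrow> 'a::real_normed_vector"
  assumes ac: "AC_on {a..b} f" and "a \<le> b" and N: "negligible N"
    and der: "\<And>x. x \<in> {a..b} - N \<Longrightarrow> (f has_vector_derivative f' x) (at x within {a..b})"
  shows "(f' has_integral (f b - f a)) {a..b}"
proof -
  define g where "g x = (if x \<in> N then 0 else f' x)" for x
  have "(g has_integral (f b - f a)) {a..b}"
    unfolding has_integral_real
  proof (intro allI impI)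
    fix e :: real
    assume "e > 0"
    \<comment> \<open>The added 1 keeps the denominator positive when \<open>a = b\<close>.\<close>
    define e' where "e' = e / (2 * (b - a + 1))"
    have "e' > 0" and e': "e' * (b - a) \<le> e / 2"
      using \<open>e > 0\<close> \<open>a \<le> b\<close> by (auto simp: e'_def field_simps)
    have "\<forall>x. \<exists>d>0. x \<in> {a..b} - N \<longrightarrow>
         (\<forall>y\<in>{a..b}. norm (y-x) < d \<longrightarrow> norm (f y - f x - (y-x) *\<^sub>R f' x) \<le> e' * norm (y-x))"
    proof
      fix x
      have "\<exists>d>0. \<forall>y\<in>{a..b}. norm (y-x) < d \<longrightarrow> norm (f y - f x - (y-x) *\<^sub>R f' x) \<le> e' * norm (y-x)"
        if "x \<in> {a..b} - N"
        using der[OF that] \<open>e' > 0\<close> unfolding has_vector_derivative_def has_derivative_within_alt by blast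
      then show "\<exists>d>0. x \<in> {a..b} - N \<longrightarrow>
          (\<forall>y\<in>{a..b}. norm (y-x) < d \<longrightarrow> norm (f y - f x - (y-x) *\<^sub>R f' x) \<le> e' * norm (y-x))"
        by (cases "x \<in> {a..b} - N") (blast, use zero_less_one in blast)
    qed
    from choice[OF this] obtain d where d_all: "\<forall>x. 0 < d x \<and> (x \<in> {a..b} - N \<longrightarrow>
          (\<forall>y\<in>{a..b}. norm (y-x) < d x \<longrightarrow> norm (f y - f x - (y-x) *\<^sub>R f' x) \<le> e' * norm (y-x)))" ..
    have d: "\<And>x. 0 < d x"
        "\<And>x y. \<lbrakk>x \<in> {a..b} - N; y \<in> {a..b}; norm (y-x) < d x\<rbrakk>
           \<Longrightarrow> norm (f y - f x - (y-x) *\<^sub>R f' x) \<le> e' * norm (y-x)"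
      using d_all by blast+
    have "e / 2 > 0" using \<open>e > 0\<close> by simp
    with ac obtain d0 where "d0 > 0" and d0': "\<forall>D. D division_of \<Union>D \<and> \<Union>D \<subseteq> {a..b} \<and>
        (\<Sum>k\<in>D. Sup k - Inf k) < d0 \<longrightarrow> (\<Sum>k\<in>D. norm (f (Sup k) - f (Inf k))) < e / 2"
      unfolding AC_on_def by meson
    have d0: "\<And>D. D division_of \<Union>D \<Longrightarrow> \<Union>D \<subseteq> {a..b} \<Longrightarrow>
        (\<Sum>k\<in>D. Sup k - Inf k) < d0 \<Longrightarrow> (\<Sum>k\<in>D. norm (f (Sup k) - f (Inf k))) < e / 2"
      using d0' by blast
    obtain U where "open U" "N \<subseteq> U" and Um: "U - N \<in> lmeasurable"
        and Ue: "emeasure lebesgue (U - N) < ennreal d0"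
      using sets_lebesgue_outer_open[of N d0] N \<open>d0 > 0\<close> by (metis negligible_imp_sets)
    have Ueq: "U = (U - N) \<union> N" using \<open>N \<subseteq> U\<close> by blast
    have Ul: "U \<in> lmeasurable"
      by (subst Ueq) (intro fmeasurable.Un Um negligible_imp_measurable N)
    have "measure lebesgue U = measure lebesgue (U - N)"
      by (subst Ueq) (intro measure_Un_null_set fmeasurableD Um, use N negligible_iff_null_sets in blast)
    then have Ud: "measure lebesgue U < d0"
      using Ue Um \<open>d0 > 0\<close> by (simp add: emeasure_eq_measure2 ennreal_less_iff)
    define \<gamma> where "\<gamma> x = (if x \<in> N then U else ball x (d x))" for x
    have g1: "gauge \<gamma>"
      using \<open>open U\<close> \<open>N \<subseteq> U\<close> d(1) by (auto simp: gauge_def \<gamma>_def)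
    have g2: "norm (sum (\<lambda>(x,k). measure lborel k *\<^sub>R g x) p - (f b - f a)) < e"
      if ptag: "p tagged_division_of {a..b}" and finep: "\<gamma> fine p" for p
    proof -
      have fin: "finite p" using ptag by blast
      define P where "P = {z \<in> p. fst z \<in> N}"
      define F where "F = (\<lambda>(x::real, K). measure lborel K *\<^sub>R g x - (f (Sup K) - f (Inf K)))"
      have "sum (\<lambda>(x,k). measure lborel k *\<^sub>R g x) p - (f b - f a) = sum F p"
        using additive_tagged_division_1[OF \<open>a \<le> b\<close> ptag, of f]
        by (simp add: F_def split_def sum_subtractf)
      also have "\<dots> = sum F (p - P) + sum F P"
        by (rule sum.subset_diff) (auto simp: P_def fin)
      finally have split: "norm (sum (\<lambda>(x,k). measure lborel k *\<^sub>R g x) p - (f b - f a))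
          \<le> norm (sum F (p - P)) + norm (sum F P)"
        by (simp add: norm_triangle_ineq)
      have "norm (sum F (p - P)) \<le> (\<Sum>(x,K)\<in>p - P. e' * (Sup K - Inf K))"
      proof (rule sum_norm_le, safe)
        fix x K
        assume xK: "(x, K) \<in> p" "(x, K) \<notin> P"
        then have "x \<notin> N" by (auto simp: P_def)
        from xK have "x \<in> K" and kab: "K \<subseteq> {a..b}"
          using ptag by blast+
        then obtain u v where k: "K = cbox u v"
          using ptag xK by blast
        have "u \<le> v" using \<open>x \<in> K\<close> unfolding k by auto
        have ball: "\<forall>y\<in>K. y \<in> ball x (d x)"
          using finep xK \<open>x \<notin> N\<close> by (fastforce simp: \<gamma>_def fine_def)
        have "u \<in> K" "v \<in> K" by (simp_all add: \<open>u \<le> v\<close> k)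
        have "x \<in> {a..b} - N" using \<open>x \<notin> N\<close> \<open>x \<in> K\<close> kab by auto
        have "norm ((v - u) *\<^sub>R f' x - (f v - f u))
            = norm (f u - f x - (u - x) *\<^sub>R f' x - (f v - f x - (v - x) *\<^sub>R f' x))"
          by (auto simp: algebra_simps)
        also have "\<dots> \<le> norm (f u - f x - (u - x) *\<^sub>R f' x) + norm (f v - f x - (v - x) *\<^sub>R f' x)"
          by (rule norm_triangle_ineq4)
        also have "\<dots> \<le> e' * norm (u - x) + e' * norm (v - x)"
          using ball \<open>u \<in> K\<close> \<open>v \<in> K\<close> kab
          by (intro add_mono d(2)[OF \<open>x \<in> {a..b} - N\<close>]) (auto simp: dist_real_def)
        also have "\<dots> = e' * (Sup K - Inf K)"
          using \<open>x \<in> K\<close> \<open>u \<le> v\<close> by (auto simp: k field_simps)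
        finally show "norm (F (x, K)) \<le> e' * (Sup K - Inf K)"
          using \<open>u \<le> v\<close> \<open>x \<notin> N\<close> by (simp add: k F_def g_def)
      qed
      also have "\<dots> \<le> (\<Sum>(x,K)\<in>p. e' * (Sup K - Inf K))"
      proof (rule sum_mono2[OF fin])
        show "0 \<le> (case z of (x, K) \<Rightarrow> e' * (Sup K - Inf K))" if "z \<in> p - (p - P)" for z
        proof -
          obtain x K where z: "z = (x, K)" "(x, K) \<in> p" using \<open>z \<in> p - (p - P)\<close> by (cases z) auto
          then obtain u v where "K = cbox u v" "x \<in> K" using ptag by blast
          then show ?thesis using \<open>e' > 0\<close> by (auto simp: z)
        qed
      qed blast
      also have "\<dots> = e' * (b - a)"
        using additive_tagged_division_1[OF \<open>a \<le> b\<close> ptag, of "\<lambda>x. x"]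
        by (simp add: sum_distrib_left[symmetric] split_def)
      finally have le1: "norm (sum F (p - P)) \<le> e / 2" using e' by linarith
      have part: "P tagged_partial_division_of {a..b}"
        by (rule tagged_partial_division_subset[of p]) (use ptag in \<open>auto simp: P_def tagged_division_of_def\<close>)
      define D where "D = snd ` P"
      have D: "D division_of \<Union>D"
        unfolding D_def by (rule partial_division_of_tagged_division[OF part])
      have Dab: "\<Union>D \<subseteq> {a..b}"
        using ptag by (fastforce simp: D_def P_def)
      have DU: "\<Union>D \<subseteq> U"
        using finep by (fastforce simp: D_def P_def \<gamma>_def fine_def)
      have "(\<Sum>k\<in>D. Sup k - Inf k) = (\<Sum>k\<in>D. measure lebesgue k)"
      proof (rule sum.cong[OF refl])
        fix k assume "k \<in> D"
        then obtain u v where "k = cbox u v" "k \<noteq> {}" using division_ofD[OF D] by metis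
        then show "Sup k - Inf k = measure lebesgue k" by auto
      qed
      also have "\<dots> = measure lebesgue (\<Union>D)" by (rule content_division[OF D])
      also have "\<dots> \<le> measure lebesgue U"
        using DU Ul fmeasurableD[OF lmeasurable_division[OF D]] by (intro measure_mono_fmeasurable)
      finally have small: "(\<Sum>k\<in>D. norm (f (Sup k) - f (Inf k))) < e / 2"
        using Ud by (intro d0 D Dab) auto
      \<comment> \<open>\<open>Sup\<close> and \<open>Inf\<close> of the empty set are unspecified,
        hence the default 0: the passage from tagged pairs to their intervals requires empty and
        degenerate intervals to contribute nothing.\<close>
      define h where "h K = (if K = {} then 0 else norm (f (Sup K) - f (Inf K)))" for K
      have ne: "K \<noteq> {}" if "(x, K) \<in> p" for x K
        using ptag that by blast
      have "norm (sum F P) \<le> (\<Sum>(x,K)\<in>P. h K)"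
        by (rule sum_norm_le) (use ne in \<open>auto simp: F_def g_def P_def h_def norm_minus_commute\<close>)
      also have "\<dots> = sum h (snd ` P)"
      proof (rule sum.over_tagged_division_lemma[OF tagged_partial_division_of_Union_self[OF part]])
        fix u v :: real
        assume "box u v = {}"
        then show "h (cbox u v) = 0" by (cases "u = v") (auto simp: h_def)
      qed
      also have "\<dots> = (\<Sum>k\<in>D. norm (f (Sup k) - f (Inf k)))"
        unfolding D_def by (rule sum.cong) (use ne in \<open>auto simp: h_def P_def\<close>)
      finally show ?thesis using small le1 split by linarith
    qed
    show "\<exists>\<gamma>. gauge \<gamma> \<and> (\<forall>\<D>. \<D> tagged_division_of {a..b} \<and> \<gamma> fine \<D> \<longrightarrow>
        norm (sum (\<lambda>(x,k). measure lborel k *\<^sub>R g x) \<D> - (f b - f a)) < e)"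
      by (intro exI[of _ \<gamma>] conjI allI impI g1) (elim conjE, rule g2)
  qed
  then show ?thesis
    by (rule has_integral_spike[OF N, rotated]) (auto simp: g_def)
qed

section \<open>Lipschitz functions and the size of their gradients\<close>

lemma lipschitz_on_imp_AC_on:
  fixes f :: "real \<Rightarrow> 'a::real_normed_vector"
  assumes "C-lipschitz_on S f"
  shows "AC_on S f"
  unfolding AC_on_def
proof (intro allI impI)
  fix e :: real assume "e > 0"
  have "C \<ge> 0" by (rule lipschitz_on_nonneg[OF assms])
  show "\<exists>d>0. \<forall>D. D division_of \<Union>D \<and> \<Union>D \<subseteq> S \<and> (\<Sum>k\<in>D. Sup k - Inf k) < d \<longrightarrow>
      (\<Sum>k\<in>D. norm (f (Sup k) - f (Inf k))) < e"
  proof (intro exI[of _ "e / (C + 1)"] conjI allI impI; (elim conjE)?)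
    show "e / (C + 1) > 0" using \<open>e > 0\<close> \<open>C \<ge> 0\<close> by simp
    fix D assume D: "D division_of \<Union>D" "\<Union>D \<subseteq> S" and small: "(\<Sum>k\<in>D. Sup k - Inf k) < e / (C + 1)"
    have le: "norm (f (Sup k) - f (Inf k)) \<le> C * (Sup k - Inf k) \<and> 0 \<le> Sup k - Inf k" if kD: "k \<in> D" for k
    proof -
      obtain u v where k: "k = {u..v}" and "k \<noteq> {}"
        using division_ofD(3,4)[OF D(1) kD] by (metis box_real(2))
      then have "u \<le> v" by auto
      moreover have "{u..v} \<subseteq> S" using D(2) kD k by blast
      then have "u \<in> S" "v \<in> S" using \<open>u \<le> v\<close> by auto
      ultimately show ?thesis
        using lipschitz_on_normD[OF assms, of v u] by (simp add: k)
    qed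
    have "(\<Sum>k\<in>D. norm (f (Sup k) - f (Inf k))) \<le> (\<Sum>k\<in>D. C * (Sup k - Inf k))"
      using le by (intro sum_mono) blast
    also have "\<dots> \<le> (C + 1) * (\<Sum>k\<in>D. Sup k - Inf k)"
      using le by (simp add: sum_distrib_left[symmetric] distrib_right sum_nonneg)
    also have "\<dots> < e" using small \<open>C \<ge> 0\<close> by (simp add: field_simps)
    finally show "(\<Sum>k\<in>D. norm (f (Sup k) - f (Inf k))) < e" .
  qed
qed

text \<open>By Fubini, almost every translate of the segment from \<open>x\<close> to \<open>y\<close> meets the exceptional null set
  in a set of length zero, and along such a translate \<open>g\<close> is the integral of its gradient.\<close>

lemma lipschitz_gradient_bound:
  fixes g :: "'a::euclidean_space \<Rightarrow> real"
  assumes lip: "C-lipschitz_on UNIV g"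
    and ae: "AE x in lebesgue. GDERIV g x :> Dg x \<and> norm (Dg x) \<le> G"
  shows "\<bar>g y - g x\<bar> \<le> G * norm (y - x)"
proof -
  have "AE x in lborel. GDERIV g x :> Dg x \<and> norm (Dg x) \<le> G"
    using ae by (simp add: AE_completion_iff)
  then obtain N where N: "N \<in> null_sets lborel"
    and good: "\<And>z. z \<notin> N \<Longrightarrow> GDERIV g z :> Dg z \<and> norm (Dg z) \<le> G"
    unfolding eventually_ae_filter by auto
  have [measurable]: "N \<in> sets borel" using N by auto
  have "G \<ge> 0"
  proof -
    have "N \<noteq> UNIV" using N open_not_negligible[of "UNIV :: 'a set"]
      by (auto simp: negligible_iff_null_sets null_sets_completionI)
    then obtain z where "z \<notin> N" by auto
    then show ?thesis using good[of z] norm_ge_zero[of "Dg z"] by linarith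
  qed
  define v where "v = y - x"
  define P where "P e s \<longleftrightarrow> e + (x + s *\<^sub>R v) \<notin> N" for e and s :: real
  have "(AE e in lborel. AE s in lborel. P e s) \<longleftrightarrow> (AE s in lborel. AE e in lborel. P e s)"
  proof (rule lborel_pair.AE_commute)
    have "(\<lambda>w. fst w + (x + snd w *\<^sub>R v)) \<in> borel_measurable (lborel \<Otimes>\<^sub>M lborel)" by measurable
    then show "{w \<in> space (lborel \<Otimes>\<^sub>M lborel). P (fst w) (snd w)} \<in> sets (lborel \<Otimes>\<^sub>M lborel)"
      unfolding P_def by measurable
  qed
  moreover have "AE e in lborel. P e s" for s
  proof -
    have "{e. e + (x + s *\<^sub>R v) \<in> N} \<in> null_sets lborel"
      using null_sets_translation[OF N, of "- (x + s *\<^sub>R v)"] by (simp only: diff_minus_eq_add)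
    then show ?thesis unfolding P_def by (rule AE_I') auto
  qed
  ultimately have "AE e in lborel. AE s in lborel. P e s" by simp
  then have bound: "AE e in lborel. \<bar>g (e + y) - g (e + x)\<bar> \<le> G * norm v"
  proof (rule AE_mp, intro AE_I2 impI)
    fix e assume "AE s in lborel. P e s"
    then obtain S where S: "S \<in> null_sets lborel" "\<And>s. s \<notin> S \<Longrightarrow> P e s"
      unfolding eventually_ae_filter by auto
    define Z where "Z s = e + (x + s *\<^sub>R v)" for s
    have "negligible S" using S by (simp add: negligible_iff_null_sets null_sets_completionI)
    have "(C * norm v)-lipschitz_on {0..1} (\<lambda>s. g (Z s))"
    proof (rule lipschitz_onI)
      fix s r :: real
      have "dist (Z s) (Z r) = norm v * dist s r"
        by (simp add: Z_def dist_norm scaleR_diff_left[symmetric] mult.commute)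
      then show "dist (g (Z s)) (g (Z r)) \<le> C * norm v * dist s r"
        using lipschitz_onD[OF lip, of "Z s" "Z r"] by simp
    qed (use lipschitz_on_nonneg[OF lip] in simp)
    then have AC: "AC_on {0..1} (\<lambda>s. g (Z s))" by (rule lipschitz_on_imp_AC_on)
    \<comment> \<open>The value 0 on the exceptional set makes the bound on the integrand valid at
      every \<open>s\<close>, as the integral estimate below requires.\<close>
    have "((\<lambda>s. if s \<in> S then 0 else v \<bullet> Dg (Z s)) has_integral (g (Z 1) - g (Z 0))) {0..1}"
    proof (rule AC_on_has_integral[OF AC _ \<open>negligible S\<close>])
      fix s :: real assume s: "s \<in> {0..1} - S"
      then have "(g has_derivative (\<lambda>k. k \<bullet> Dg (Z s))) (at (Z s))"
        using S(2)[of s] good unfolding P_def Z_def gderiv_def by auto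
      moreover have "(Z has_derivative (\<lambda>k. k *\<^sub>R v)) (at s)"
        unfolding Z_def by (auto intro!: derivative_eq_intros)
      ultimately have "((\<lambda>s. g (Z s)) has_derivative (\<lambda>k. (k *\<^sub>R v) \<bullet> Dg (Z s))) (at s)"
        using has_derivative_compose by blast
      then show "((\<lambda>s. g (Z s)) has_vector_derivative (if s \<in> S then 0 else v \<bullet> Dg (Z s))) (at s within {0..1})"
        using s by (auto simp: has_vector_derivative_def intro: has_derivative_at_withinI)
    qed simp
    moreover have "norm (if s \<in> S then 0 else v \<bullet> Dg (Z s)) \<le> G * norm v" for s
    proof (cases "s \<in> S")
      case False
      then have "norm (Dg (Z s)) \<le> G" using S(2) good unfolding P_def Z_def by blast
      then show ?thesis
        using False Cauchy_Schwarz_ineq2[of v "Dg (Z s)"] mult_left_mono[of "norm (Dg (Z s))" G "norm v"]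
        by (simp add: mult.commute)
    qed (use \<open>G \<ge> 0\<close> in simp)
    ultimately have "norm (g (Z 1) - g (Z 0)) \<le> G * norm v * measure lborel {0..1::real}"
      using \<open>G \<ge> 0\<close> by (intro has_integral_bound_real) auto
    then show "\<bar>g (e + y) - g (e + x)\<bar> \<le> G * norm v" by (simp add: Z_def v_def)
  qed
  \<comment> \<open>So far the bound holds for almost every translate \<open>e\<close>. The set of
    failures is open by continuity of \<open>g\<close> and null, hence empty; in particular
    \<open>e = 0\<close> is allowed.\<close>
  define V where "V = {e. G * norm v < \<bar>g (e + y) - g (e + x)\<bar>}"
  have gcont: "continuous_on UNIV (\<lambda>e. g (e + c))" for c
    using lipschitz_on_continuous_on[OF lip]
    by (rule continuous_on_compose2) (auto intro: continuous_intros)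
  have "open V"
    unfolding V_def by (intro open_Collect_less continuous_intros gcont)
  moreover have "negligible V"
  proof -
    have "V \<in> sets lborel" using \<open>open V\<close> by simp
    moreover have "AE e in lborel. e \<notin> V" using bound by (simp add: V_def not_less)
    ultimately have "V \<in> null_sets lborel" by (simp add: AE_iff_null_sets)
    then show ?thesis by (simp add: negligible_iff_null_sets null_sets_completionI)
  qed
  ultimately have "V = {}" using open_not_negligible by blast
  then have "0 \<notin> V" by simp
  then show ?thesis by (simp add: V_def v_def)
qed

text \<open>The constant \<open>C\<close> is merely qualitative; it is replaced by \<open>G\<close>,
  on which the speed bound may depend.\<close>

lemma gradient_Linfty_norm_imp_lipschitz:
  assumes "C-lipschitz_on UNIV g" "gradient_Linfty_norm g G"
  shows "\<bar>g y - g x\<bar> \<le> G * norm (y - x)"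
proof -
  obtain Dg where Dg: "AE x in lebesgue. GDERIV g x :> Dg x"
    "esssup lebesgue (\<lambda>x. ereal (norm (Dg x))) = ereal G"
    using assms(2) unfolding gradient_Linfty_norm_def by blast
  have "AE x in lebesgue. norm (Dg x) \<le> G"
    using esssup_AE[of "\<lambda>x. ereal (norm (Dg x))" lebesgue] by (simp add: Dg(2))
  with Dg(1) have "AE x in lebesgue. GDERIV g x :> Dg x \<and> norm (Dg x) \<le> G"
    by eventually_elim simp
  then show ?thesis by (rule lipschitz_gradient_bound[OF assms(1)])
qed

section \<open>Subsolutions along curves\<close>

text \<open>Touching on full neighbourhoods makes the property local, so that it restricts to small
  balls. The scale \<open>\<epsilon>\<close> is absorbed into \<open>h\<close>.\<close>

definition interior_subsolution ::
    "('a::euclidean_space \<Rightarrow> 'a \<Rightarrow> real) \<Rightarrow> 'a set \<Rightarrow> ('a \<Rightarrow> real \<Rightarrow> real) \<Rightarrow> bool" where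
  "interior_subsolution h W u \<longleftrightarrow>
     (\<forall>x\<in>W. \<forall>t>0. \<forall>\<phi> D\<phi> p q.
        C1_with_gradient \<phi> D\<phi> \<and> D\<phi> (x, t) = (p, q) \<and>
        (\<forall>\<^sub>F (y, s) in nhds (x, t). u y s - \<phi> (y, s) \<le> u x t - \<phi> (x, t)) \<longrightarrow>
        q + h x p \<le> 0)"

text \<open>Comparison with the linear function of time of slope \<open>l\<close>, in a tube around
  the segment. If the inequality failed, penalties would force a maximum of
  \<open>u - \<phi>\<close> inside the tube. The time derivative of \<open>\<phi>\<close> there is
  \<open>l\<close> plus a positive term minus \<open>p \<bullet> v\<close>, where \<open>p\<close>
  is its spatial gradient, so the subsolution property makes \<open>p \<bullet> v - h y p\<close>
  exceed \<open>l\<close>. Since \<open>l\<close> is a bound on the whole ball, one fixed penalty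
  weight \<open>A\<close> is enough.\<close>

lemma subsolution_along_segment:
  fixes u :: "'a::euclidean_space \<Rightarrow> real \<Rightarrow> real"
  assumes sub: "interior_subsolution h (ball x0 R) u"
    and cont: "continuous_on (ball x0 R \<times> {0..}) (\<lambda>(x, t). u x t)"
    and ab: "0 \<le> a" "a < b"
    and z: "z \<in> ball x0 R" "z + (b - a) *\<^sub>R v \<in> ball x0 R"
    and l: "\<And>y p. y \<in> ball x0 R \<Longrightarrow> p \<bullet> v - h y p \<le> l"
  shows "u (z + (b - a) *\<^sub>R v) b - u z a \<le> l * (b - a)"
proof (rule ccontr)
  assume neg: "\<not> ?thesis"
  define Z where "Z s = z + (s - a) *\<^sub>R v" for s
  \<comment> \<open>Half of the assumed excess: one half pays for the exponential penalty at time
    \<open>b\<close>, the other keeps the maximum above the initial value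
    \<open>u z a\<close>.\<close>
  define \<theta> where "\<theta> = (u (Z b) b - u z a - l * (b - a)) / 2"
  have "\<theta> > 0" using neg by (simp add: \<theta>_def Z_def)
  have Zcont: "continuous_on S Z" for S unfolding Z_def by (intro continuous_intros)
  have "\<forall>\<^sub>F s in at_right b. Z s \<in> ball x0 R"
  proof (rule topological_tendstoD)
    show "(Z \<longlongrightarrow> Z b) (at_right b)" unfolding Z_def by (intro tendsto_intros)
  qed (use z in \<open>auto simp: Z_def\<close>)
  then obtain b1 where "b1 > b" and b1: "\<And>s. b < s \<Longrightarrow> s < b1 \<Longrightarrow> Z s \<in> ball x0 R"
    by (auto simp: eventually_at_right_field)
  \<comment> \<open>Prolonging the segment makes \<open>b\<close> an interior time. The exponential
    penalty equals \<open>\<theta>\<close> at \<open>b\<close> and is large at \<open>c\<close>,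
    which excludes a maximum at the final time.\<close>
  define c where "c = (b + b1) / 2"
  have c: "b < c" "Z c \<in> ball x0 R" using \<open>b1 > b\<close> b1[of c] by (auto simp: c_def)
  have Zball: "Z s \<in> ball x0 R" if "s \<in> {a..c}" for s
  proof -
    have "closed_segment z (Z c) \<subseteq> ball x0 R"
      using z c by (intro closed_segment_subset convex_ball) auto
    moreover have "Z s \<in> closed_segment z (Z c)"
      unfolding in_segment
    proof (intro exI[of _ "(s - a) / (c - a)"] conjI)
      have "(s - a) / (c - a) * (c - a) = s - a" using c ab by simp
      moreover have "(1 - q) *\<^sub>R z + q *\<^sub>R Z c = z + (q * (c - a)) *\<^sub>R v" for q
        by (simp add: Z_def algebra_simps)
      ultimately show "Z s = (1 - (s - a) / (c - a)) *\<^sub>R z + ((s - a) / (c - a)) *\<^sub>R Z c"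
        by (metis Z_def)
    qed (use that c ab in auto)
    ultimately show ?thesis by blast
  qed
  have "compact (Z ` {a..c})" by (intro compact_continuous_image Zcont) auto
  then obtain \<rho>1 where "\<rho>1 > 0" and \<rho>1: "\<And>s y. s \<in> {a..c} \<Longrightarrow> dist (Z s) y < \<rho>1 \<Longrightarrow> y \<in> ball x0 R"
  proof -
    have "Z ` {a..c} \<subseteq> ball x0 R" using Zball by auto
    then obtain e where "e > 0" "(\<Union>x\<in>Z ` {a..c}. ball x e) \<subseteq> ball x0 R"
      using compact_subset_open_imp_ball_epsilon_subset[OF \<open>compact (Z ` {a..c})\<close> open_ball] by metis
    then show ?thesis by (intro that[of e]) force+
  qed
  have "\<forall>\<^sub>F y in at z. \<bar>u y a - u z a\<bar> < \<theta>"
  proof -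
    have "continuous_on (ball x0 R) (\<lambda>y. u y a)"
    proof -
      have "continuous_on (ball x0 R) ((\<lambda>(x, t). u x t) \<circ> (\<lambda>y. (y, a)))"
        using ab by (intro continuous_on_compose continuous_on_subset[OF cont] continuous_intros) auto
      then show ?thesis by (simp add: o_def)
    qed
    then have "((\<lambda>y. u y a) \<longlongrightarrow> u z a) (at z)"
      using z by (simp add: continuous_on_eq_continuous_at isCont_def)
    then show ?thesis using \<open>\<theta> > 0\<close> by (auto simp: tendsto_iff dist_real_def)
  qed
  then obtain \<rho>2 where "\<rho>2 > 0" and \<rho>2: "\<And>y. dist y z < \<rho>2 \<Longrightarrow> \<bar>u y a - u z a\<bar> < \<theta>"
    using \<open>\<theta> > 0\<close> unfolding eventually_at by (metis abs_zero cancel_comm_monoid_add_class.diff_cancel UNIV_I)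
  define \<rho> where "\<rho> = min \<rho>1 \<rho>2 / 2"
  have \<rho>: "\<rho> > 0" "\<rho> < \<rho>1" "\<rho> < \<rho>2" using \<open>\<rho>1 > 0\<close> \<open>\<rho>2 > 0\<close> by (auto simp: \<rho>_def)
  define C where "C = (\<lambda>(e, s). (Z s + e, s)) ` (cball 0 \<rho> \<times> {a..c})"
  have C_iff: "(y, s) \<in> C \<longleftrightarrow> a \<le> s \<and> s \<le> c \<and> norm (y - Z s) \<le> \<rho>" for y s
    unfolding C_def by (auto simp: image_iff intro!: bexI[of _ "y - Z s"])
  have "compact C"
    unfolding C_def split_def Z_def
    by (intro compact_continuous_image compact_Times continuous_intros) auto
  have Csub: "C \<subseteq> ball x0 R \<times> {0..}"
  proof clarify
    fix y s assume "(y, s) \<in> C"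
    then have "a \<le> s" "s \<le> c" "norm (y - Z s) \<le> \<rho>" by (auto simp: C_iff)
    then show "y \<in> ball x0 R \<and> s \<in> {0..}"
      using \<rho>1[of s y] \<rho> ab by (auto simp: dist_norm norm_minus_commute)
  qed
  have ucont: "continuous_on C (\<lambda>(x, t). u x t)" by (rule continuous_on_subset[OF cont Csub])
  have "bounded ((\<lambda>(x, t). u x t - l * (t - a)) ` C)"
  proof (intro compact_imp_bounded compact_continuous_image)
    show "continuous_on C (\<lambda>(x, t). u x t - l * (t - a))"
      using ucont unfolding split_def by (intro continuous_intros)
  qed fact
  then obtain M where M: "\<And>y s. (y, s) \<in> C \<Longrightarrow> \<bar>u y s - l * (s - a)\<bar> \<le> M"
    unfolding bounded_iff by fastforce
  have "(Z b, b) \<in> C" using ab c \<rho> by (simp add: C_iff)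
  then have "M \<ge> 0" using M by force
  \<comment> \<open>Both constants make a penalty exceed \<open>2 * M + \<theta>\<close>, the most
    that \<open>big\<close>, \<open>low\<close> and \<open>up\<close> allow: \<open>N\<close> acts
    at the final time \<open>c\<close>, through \<open>exp x \<ge> 1 + x\<close>, and
    \<open>A\<close> on the lateral surface of the tube.\<close>
  define N where "N = (2 * M + \<theta> + 1) / (\<theta> * (c - b))"
  define A where "A = (2 * M + \<theta> + 1) / \<rho>\<^sup>2"
  have "N > 0" "A > 0" using \<open>M \<ge> 0\<close> \<open>\<theta> > 0\<close> c \<rho> by (auto simp: N_def A_def intro!: divide_pos_pos)
  define \<phi> where "\<phi> = (\<lambda>(y::'a, s). l * (s - a) + \<theta> * exp (N * (s - b)) + A * ((y - Z s) \<bullet> (y - Z s)))"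
  define D\<phi> where "D\<phi> = (\<lambda>(y::'a, s). ((2 * A) *\<^sub>R (y - Z s),
      l + \<theta> * N * exp (N * (s - b)) - 2 * A * ((y - Z s) \<bullet> v)))"
  have C1: "C1_with_gradient \<phi> D\<phi>"
    unfolding C1_with_gradient_def gderiv_def
  proof (intro conjI allI)
    fix x :: "'a \<times> real"
    show "(\<phi> has_derivative (\<lambda>h. h \<bullet> D\<phi> x)) (at x)"
      unfolding \<phi>_def D\<phi>_def Z_def split_def
      by (auto intro!: derivative_eq_intros simp: inner_prod_def inner_simps algebra_simps inner_commute)
    show "continuous_on UNIV D\<phi>"
      unfolding D\<phi>_def Z_def split_def by (intro continuous_intros)
  qed
  have "continuous_on C (\<lambda>w. (\<lambda>(x, t). u x t) w - \<phi> w)"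
    using ucont unfolding \<phi>_def Z_def split_def by (intro continuous_intros)
  then obtain w where "w \<in> C" and w: "\<And>w'. w' \<in> C \<Longrightarrow> (\<lambda>(x, t). u x t) w' - \<phi> w' \<le> (\<lambda>(x, t). u x t) w - \<phi> w"
    using continuous_attains_sup[OF \<open>compact C\<close>] \<open>(Z b, b) \<in> C\<close> by blast
  obtain y s where ys: "w = (y, s)" by (cases w)
  have yC: "(y, s) \<in> C" using \<open>w \<in> C\<close> ys by simp
  have max: "u y' s' - \<phi> (y', s') \<le> u y s - \<phi> (y, s)" if "(y', s') \<in> C" for y' s'
    using w[OF that] by (simp add: ys)
  have big: "u (Z b) b - l * (b - a) - \<theta> \<le> u y s - \<phi> (y, s)"
    using max[OF \<open>(Z b, b) \<in> C\<close>] by (simp add: \<phi>_def)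
  then have big': "u z a + \<theta> \<le> u y s - \<phi> (y, s)" by (simp add: \<theta>_def field_simps)
  have low: "- M - \<theta> \<le> u (Z b) b - l * (b - a) - \<theta>" using M[OF \<open>(Z b, b) \<in> C\<close>] by linarith
  have up: "u y s - l * (s - a) \<le> M" using M[OF yC] by linarith
  have pos: "0 < \<theta> * exp (N * (s - b))" "0 \<le> A * ((y - Z s) \<bullet> (y - Z s))"
    using \<open>\<theta> > 0\<close> \<open>A > 0\<close> by auto
  have "s \<noteq> a"
  proof
    assume "s = a"
    then have "norm (y - z) \<le> \<rho>" using yC by (simp add: C_iff Z_def)
    then have "u y a < u z a + \<theta>" using \<rho>2[of y] \<rho> by (auto simp: dist_norm abs_less_iff)
    then show False using big' pos \<open>s = a\<close> by (simp add: \<phi>_def)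
  qed
  moreover have "s \<noteq> c"
  proof
    assume "s = c"
    have "2 * M + \<theta> + 1 = \<theta> * (N * (c - b))" using \<open>\<theta> > 0\<close> c by (simp add: N_def)
    also have "\<dots> \<le> \<theta> * exp (N * (c - b))"
      using exp_ge_add_one_self[of "N * (c - b)"] \<open>\<theta> > 0\<close> by (intro mult_left_mono) linarith+
    finally show False using big low up pos(2) \<open>s = c\<close> by (simp add: \<phi>_def)
  qed
  ultimately have s: "a < s" "s < c" using yC by (auto simp: C_iff)
  have "norm (y - Z s) \<noteq> \<rho>"
  proof
    assume "norm (y - Z s) = \<rho>"
    then have "A * ((y - Z s) \<bullet> (y - Z s)) = 2 * M + \<theta> + 1"
      using \<rho> by (simp add: A_def power2_norm_eq_inner[symmetric])
    then show False using big low up pos(1) by (simp add: \<phi>_def)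
  qed
  then have y: "norm (y - Z s) < \<rho>" using yC by (auto simp: C_iff)
  define V where "V = {w::'a \<times> real. a < snd w \<and> snd w < c \<and> norm (fst w - Z (snd w)) < \<rho>}"
  have "open V"
    unfolding V_def Z_def by (intro open_Collect_conj open_Collect_less continuous_intros)
  have "\<forall>\<^sub>F (y', s') in nhds (y, s). u y' s' - \<phi> (y', s') \<le> u y s - \<phi> (y, s)"
    unfolding eventually_nhds
  proof (intro exI[of _ V] conjI ballI)
    show "(y, s) \<in> V" using s y by (simp add: V_def)
    fix w' assume "w' \<in> V"
    then show "case w' of (y', s') \<Rightarrow> u y' s' - \<phi> (y', s') \<le> u y s - \<phi> (y, s)"
      using max by (cases w') (auto simp: V_def C_iff)
  qed fact
  moreover have yball: "y \<in> ball x0 R" and "s > 0" using yC Csub s ab by auto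
  ultimately have "snd (D\<phi> (y, s)) + h y (fst (D\<phi> (y, s))) \<le> 0"
    using C1 by (intro sub[unfolded interior_subsolution_def, rule_format]) auto
  then have "l + \<theta> * N * exp (N * (s - b)) \<le> ((2 * A) *\<^sub>R (y - Z s)) \<bullet> v - h y ((2 * A) *\<^sub>R (y - Z s))"
    by (simp add: D\<phi>_def)
  also have "\<dots> \<le> l" by (rule l[OF yball])
  finally show False using mult_pos_pos[OF mult_pos_pos[OF \<open>\<theta> > 0\<close> \<open>N > 0\<close>] exp_gt_zero[of "N * (s - b)"]] by linarith
qed

section \<open>Hamiltonians of quadratic growth and their Legendre transforms\<close>

locale quadratic_hamiltonian =
  fixes h :: "'a::euclidean_space \<Rightarrow> 'a \<Rightarrow> real" and K :: real
  assumes cont_h: "continuous_on UNIV (\<lambda>(y, p). h y p)"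
    and h_lower: "(norm p)\<^sup>2 / 2 - K \<le> h y p"
    and h_upper: "h y p \<le> (norm p)\<^sup>2 / 2 + K"
begin

lemma K_nonneg: "0 \<le> K"
  using h_lower[of 0] h_upper[of _ 0] by (smt (verit))

lemma legendre_upper: "p \<bullet> v - h y p \<le> (norm v)\<^sup>2 / 2 + K"
proof -
  have "p \<bullet> v \<le> (norm p)\<^sup>2 / 2 + (norm v)\<^sup>2 / 2"
    using inner_ge_zero[of "p - v"]
    by (simp add: inner_diff power2_norm_eq_inner inner_commute algebra_simps)
  then show ?thesis using h_lower[of p y] by linarith
qed

text \<open>Choose \<open>p = v\<close>. The Lagrangian enters as an arbitrary upper bound
  \<open>l\<close>, so that cruder running costs, such as the one of the half-speed competitor, are
  treated in the same way.\<close>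

lemma legendre_lower:
  assumes "\<And>p. p \<bullet> v - h y p \<le> l"
  shows "(norm v)\<^sup>2 / 2 - K \<le> l"
  using assms[of v] h_upper[of y v] by (simp add: power2_norm_eq_inner)

text \<open>The error term in \<open>v\<close> makes the estimate uniform in the velocity: a modulus of
  continuity of \<open>h\<close> is available only for bounded momenta, that is, for bounded velocities.\<close>

lemma legendre_perturbation:
  assumes "\<kappa> > 0" "k > 0"
  obtains \<delta> where "\<delta> > 0"
    "\<And>y y' v p l. y \<in> cball 0 R \<Longrightarrow> y' \<in> cball 0 R \<Longrightarrow> dist y y' < \<delta> \<Longrightarrow>
       (\<And>q. q \<bullet> v - h y' q \<le> l) \<Longrightarrow> p \<bullet> v - h y p \<le> l + (\<kappa> + 2 * K / k\<^sup>2 * (norm v)\<^sup>2)"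
proof -
  \<comment> \<open>For velocities up to \<open>k\<close>, momenta beyond \<open>P\<close> are
    harmless: quadratic growth pushes \<open>p \<bullet> v - h y p\<close> below \<open>- K\<close>,
    and every admissible \<open>l\<close> is at least \<open>- K\<close>. Uniform continuity is thus
    needed only for momenta in a ball.\<close>
  define P where "P = 2 * k + 2 * K + 2"
  have "compact (cball (0::'a) R \<times> cball (0::'a) P)" by (intro compact_Times) auto
  then have "uniformly_continuous_on (cball 0 R \<times> cball 0 P) (\<lambda>(y, p). h y p)"
    by (intro compact_uniformly_continuous continuous_on_subset[OF cont_h]) auto
  then obtain \<delta> where "\<delta> > 0" and \<delta>: "\<And>w w'. w \<in> cball 0 R \<times> cball 0 P \<Longrightarrow> w' \<in> cball 0 R \<times> cball 0 P \<Longrightarrow>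
      dist w' w < \<delta> \<Longrightarrow> dist ((\<lambda>(y, p). h y p) w') ((\<lambda>(y, p). h y p) w) < \<kappa>"
    using \<open>\<kappa> > 0\<close> unfolding uniformly_continuous_on_def by meson
  have "p \<bullet> v - h y p \<le> l + (\<kappa> + 2 * K / k\<^sup>2 * (norm v)\<^sup>2)"
    if y: "y \<in> cball 0 R" and y': "y' \<in> cball 0 R" and d: "dist y y' < \<delta>"
      and l: "\<And>q. q \<bullet> v - h y' q \<le> l" for y y' v p l
  proof -
    have l_low: "(norm v)\<^sup>2 / 2 - K \<le> l" by (rule legendre_lower[OF l])
    have err: "0 \<le> 2 * K / k\<^sup>2 * (norm v)\<^sup>2" using K_nonneg by simp
    consider "norm p \<le> P" | "norm p > P" "norm v \<le> k" | "norm v > k" by linarith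
    then show ?thesis
    proof cases
      case 1
      then have "dist (h y p) (h y' p) < \<kappa>"
        using \<delta>[of "(y', p)" "(y, p)"] y y' d by (simp add: dist_Pair_Pair)
      then show ?thesis using l[of p] err by (simp add: dist_real_def)
    next
      case 2
      have "p \<bullet> v \<le> norm p * k"
        using 2 norm_cauchy_schwarz[of p v] mult_left_mono[OF 2(2) norm_ge_zero[of p]] by linarith
      moreover have "2 * K \<le> norm p * (norm p / 2 - k)"
      proof -
        have "2 * K \<le> 2 * (K + 1)" by simp
        also have "\<dots> \<le> norm p * (norm p / 2 - k)"
          using 2 K_nonneg \<open>k > 0\<close> by (intro mult_mono) (auto simp: P_def)
        finally show ?thesis .
      qed
      ultimately have "p \<bullet> v - (norm p)\<^sup>2 / 2 \<le> - 2 * K"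
        by (simp add: algebra_simps power2_eq_square)
      then have "p \<bullet> v - h y p \<le> - K" using h_lower[of p y] by linarith
      also have "\<dots> \<le> l" using l_low zero_le_power2[of "norm v"] by linarith
      finally show ?thesis using err \<open>\<kappa> > 0\<close> by linarith
    next
      \<comment> \<open>The Legendre upper and lower bounds differ by \<open>2 * K\<close>; for
        \<open>norm v > k\<close> this is at most the quadratic error term, which explains its
        coefficient.\<close>
      case 3
      then have "k\<^sup>2 \<le> (norm v)\<^sup>2" using \<open>k > 0\<close> by (intro power_mono) auto
      then have "2 * K \<le> 2 * K / k\<^sup>2 * (norm v)\<^sup>2"
        using \<open>k > 0\<close> K_nonneg mult_left_mono[of "k\<^sup>2" "(norm v)\<^sup>2" "2 * K"] by (simp add: field_simps)
      then show ?thesis using legendre_upper[of p v y] l_low \<open>\<kappa> > 0\<close> by linarith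
    qed
  qed
  with \<open>\<delta> > 0\<close> show ?thesis by (rule that)
qed

end

section \<open>Curves of finite energy and the growth of subsolutions along them\<close>

definition energy_curve :: "(real \<Rightarrow> 'a::euclidean_space) \<Rightarrow> (real \<Rightarrow> 'a) \<Rightarrow> real \<Rightarrow> real \<Rightarrow> bool" where
  "energy_curve Y dY a b \<longleftrightarrow>
     (\<forall>r s. a \<le> r \<and> r \<le> s \<and> s \<le> b \<longrightarrow> (dY has_integral (Y s - Y r)) {r..s}) \<and>
     (\<lambda>r. (norm (dY r))\<^sup>2) integrable_on {a..b}"

lemma energy_curveD:
  assumes "energy_curve Y dY a b"
  shows "a \<le> r \<Longrightarrow> r \<le> s \<Longrightarrow> s \<le> b \<Longrightarrow> (dY has_integral (Y s - Y r)) {r..s}"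
    and "a \<le> r \<Longrightarrow> r \<le> s \<Longrightarrow> s \<le> b \<Longrightarrow> (\<lambda>r. (norm (dY r))\<^sup>2) integrable_on {r..s}"
  using assms unfolding energy_curve_def
  by (blast, metis atLeastatMost_subset_iff integrable_on_subinterval)

lemma energy_curve_subinterval:
  "energy_curve Y dY a b \<Longrightarrow> a \<le> r \<Longrightarrow> s \<le> b \<Longrightarrow> energy_curve Y dY r s"
  unfolding energy_curve_def
  by (metis atLeastatMost_subset_iff integrable_on_subinterval order_trans)

lemma energy_curve_continuous_on:
  assumes "energy_curve Y dY a b"
  shows "continuous_on {a..b} Y"
proof (cases "a \<le> b")
  case True
  have "continuous_on {a..b} (\<lambda>s. Y a + integral {a..s} dY)"
    using energy_curveD(1)[OF assms, of a b] True
    by (intro continuous_intros indefinite_integral_continuous_1) (auto simp: integrable_on_def)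
  then show ?thesis
  proof (rule continuous_on_eq)
    fix s assume "s \<in> {a..b}"
    then show "Y a + integral {a..s} dY = Y s"
      using integral_unique[OF energy_curveD(1)[OF assms, of a s]] by simp
  qed
qed auto

lemma interior_subsolution_subset:
  "interior_subsolution h W u \<Longrightarrow> V \<subseteq> W \<Longrightarrow> interior_subsolution h V u"
  unfolding interior_subsolution_def by blast

context quadratic_hamiltonian
begin

text \<open>The inequality is additive in the time interval, so by Bolzano induction short intervals
  suffice. There the curve is replaced by its chord. For fixed \<open>y\<close> and \<open>p\<close>
  the expression \<open>p \<bullet> v - h y p\<close> is affine in \<open>v\<close>, so its value at
  the mean velocity is the mean of its values along the curve, and the mean cost bounds it for every
  \<open>p\<close>.\<close>

lemma subsolution_along_shifted_curve:
  assumes sub: "interior_subsolution h W u" and W: "open W"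
    and cont: "continuous_on (W \<times> {0..}) (\<lambda>(x, t). u x t)"
    and ab: "0 \<le> a" "a \<le> b"
    and Y: "energy_curve Y dY a b"
    and \<Lambda>: "\<Lambda> integrable_on {a..b}" "\<And>r p. r \<in> {a..b} \<Longrightarrow> p \<bullet> dY r - h (Y r) p \<le> \<Lambda> r"
    and \<delta>: "\<delta> > 0" "\<And>y y' v p l. y \<in> cball 0 R \<Longrightarrow> y' \<in> cball 0 R \<Longrightarrow> dist y y' < \<delta> \<Longrightarrow>
       (\<And>q. q \<bullet> v - h y' q \<le> l) \<Longrightarrow> p \<bullet> v - h y p \<le> l + (\<kappa> + c * (norm v)\<^sup>2)"
    and R: "\<And>r. r \<in> {a..b} \<Longrightarrow> norm (Y r) + \<delta> \<le> R"
    and e: "norm e < \<delta> / 3" "\<And>r. r \<in> {a..b} \<Longrightarrow> Y r + e \<in> W"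
  shows "u (Y b + e) b - u (Y a + e) a \<le> integral {a..b} (\<lambda>r. \<Lambda> r + (\<kappa> + c * (norm (dY r))\<^sup>2))"
proof -
  define F where "F r = \<Lambda> r + (\<kappa> + c * (norm (dY r))\<^sup>2)" for r
  have F: "F integrable_on {r..s}" if "a \<le> r" "s \<le> b" for r s
  proof (rule integrable_on_subinterval[of F "{a..b}"])
    show "F integrable_on {a..b}"
      unfolding F_def using \<Lambda> energy_curveD(2)[OF Y, of a b] ab
      by (intro integrable_add integrable_on_mult_right) auto
  qed (use that in auto)
  define P where "P r s \<longleftrightarrow> (a \<le> r \<and> r \<le> s \<and> s \<le> b \<longrightarrow>
      u (Y s + e) s - u (Y r + e) r \<le> integral {r..s} F)" for r s
  have "P a b"
    using \<open>a \<le> b\<close>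
  proof (induction rule: Bolzano)
    case (trans r s q)
    show ?case
      unfolding P_def
    proof
      assume "a \<le> r \<and> r \<le> q \<and> q \<le> b"
      then have "integral {r..s} F + integral {s..q} F = integral {r..q} F"
        using trans by (intro Henstock_Kurzweil_Integration.integral_combine F) auto
      then show "u (Y q + e) q - u (Y r + e) r \<le> integral {r..q} F"
        using trans \<open>a \<le> r \<and> r \<le> q \<and> q \<le> b\<close> unfolding P_def by linarith
    qed
  next
    case (local x)
    then have "x \<in> {a..b}" by simp
    obtain R1 where "R1 > 0" and R1: "ball (Y x + e) R1 \<subseteq> W"
      using W e(2)[OF \<open>x \<in> {a..b}\<close>] open_contains_ball by blast
    \<comment> \<open>A point \<open>y\<close> of the ball is within
      \<open>\<rho> + \<delta> / 3 + \<rho>\<close> of every \<open>Y q\<close> on the short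
      interval: the ball radius, the translation \<open>e\<close> and the oscillation of the
      curve.\<close>
    define \<rho> where "\<rho> = min R1 (\<delta> / 3)"
    have \<rho>: "0 < \<rho>" "\<rho> \<le> R1" "\<rho> \<le> \<delta> / 3" using \<open>R1 > 0\<close> \<open>\<delta> > 0\<close> by (auto simp: \<rho>_def)
    have ball: "ball (Y x + e) \<rho> \<subseteq> W" using R1 \<rho> subset_ball[of \<rho> R1] by blast
    have "continuous (at x within {a..b}) Y"
      using energy_curve_continuous_on[OF Y] \<open>x \<in> {a..b}\<close> by (simp add: continuous_on_eq_continuous_within)
    then obtain d where "d > 0" and d: "\<And>r. r \<in> {a..b} \<Longrightarrow> dist r x < d \<Longrightarrow> dist (Y r) (Y x) < \<rho>"
      using \<rho>(1) unfolding continuous_within_eps_delta by blast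
    show ?case
      unfolding P_def
    proof (intro exI[of _ d] conjI allI impI \<open>d > 0\<close>)
      fix r s assume rs: "r \<le> x \<and> x \<le> s \<and> s - r < d" and bounds: "a \<le> r \<and> r \<le> s \<and> s \<le> b"
      show "u (Y s + e) s - u (Y r + e) r \<le> integral {r..s} F"
      proof (cases "r = s")
        case False
        then have "r < s" using bounds by simp
        have close: "dist (Y q) (Y x) < \<rho>" if "q \<in> {r..s}" for q
          using that rs bounds by (intro d) (auto simp: dist_real_def)
        \<comment> \<open>The chord velocity and the mean perturbed cost; the latter serves as the
          bound \<open>l\<close> for the segment lemma.\<close>
        define v where "v = (Y s - Y r) /\<^sub>R (s - r)"
        define l where "l = integral {r..s} F / (s - r)"
        have Ys: "Y r + e + (s - r) *\<^sub>R v = Y s + e" using \<open>r < s\<close> by (simp add: v_def)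
        have "u (Y r + e + (s - r) *\<^sub>R v) s - u (Y r + e) r \<le> l * (s - r)"
        proof (rule subsolution_along_segment[where h = h])
          show "interior_subsolution h (ball (Y x + e) \<rho>) u" by (rule interior_subsolution_subset[OF sub ball])
          show "continuous_on (ball (Y x + e) \<rho> \<times> {0..}) (\<lambda>(x, t). u x t)"
            using ball by (intro continuous_on_subset[OF cont]) auto
          show "Y r + e \<in> ball (Y x + e) \<rho>" "Y r + e + (s - r) *\<^sub>R v \<in> ball (Y x + e) \<rho>"
            using close[of r] close[of s] \<open>r < s\<close> unfolding Ys by (auto simp: dist_commute)
          show "0 \<le> r" "r < s" using ab bounds \<open>r < s\<close> by auto
          fix y p assume y: "y \<in> ball (Y x + e) \<rho>"
          have pt: "p \<bullet> dY q - h y p \<le> F q" if q: "q \<in> {r..s}" for q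
            unfolding F_def
          proof (rule \<delta>(2))
            have "q \<in> {a..b}" using q bounds by auto
            have "dist y (Y q) \<le> dist y (Y x + e) + dist (Y x + e) (Y x) + dist (Y x) (Y q)"
              using dist_triangle[of y "Y q" "Y x + e"] dist_triangle[of "Y x + e" "Y q" "Y x"] by linarith
            also have "\<dots> < \<rho> + \<delta> / 3 + \<rho>"
              using y close[OF q] e(1) by (intro add_strict_mono) (auto simp: dist_commute, simp add: dist_norm)
            finally show "dist y (Y q) < \<delta>" using \<rho> by simp
            then show "y \<in> cball 0 R"
              using R[OF \<open>q \<in> {a..b}\<close>] norm_triangle_sub[of y "Y q"] by (simp add: dist_norm)
            show "Y q \<in> cball 0 R" using R[OF \<open>q \<in> {a..b}\<close>] \<open>\<delta> > 0\<close> by simp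
            show "k \<bullet> dY q - h (Y q) k \<le> \<Lambda> q" for k by (rule \<Lambda>(2)[OF \<open>q \<in> {a..b}\<close>])
          qed
          have "((\<lambda>q. p \<bullet> dY q) has_integral (p \<bullet> (Y s - Y r))) {r..s}"
            using has_integral_linear[OF energy_curveD(1)[OF Y, of r s] bounded_linear_inner_right[of p]] bounds
            by (simp add: o_def)
          moreover have "((\<lambda>q. h y p) has_integral ((s - r) * h y p)) {r..s}"
            using has_integral_const_real[of "h y p" r s] bounds by simp
          ultimately have "((\<lambda>q. p \<bullet> dY q - h y p) has_integral (p \<bullet> (Y s - Y r) - (s - r) * h y p)) {r..s}"
            by (rule has_integral_diff)
          then have "p \<bullet> (Y s - Y r) - (s - r) * h y p \<le> integral {r..s} F"
            using bounds by (intro has_integral_le[OF _ integrable_integral[OF F] pt]) auto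
          moreover have "p \<bullet> v * (s - r) = p \<bullet> (Y s - Y r)"
            using \<open>r < s\<close> by (simp add: v_def)
          ultimately have "(p \<bullet> v - h y p) * (s - r) \<le> integral {r..s} F"
            by (simp add: algebra_simps)
          then show "p \<bullet> v - h y p \<le> l"
            using \<open>r < s\<close> by (simp add: l_def pos_le_divide_eq)
        qed
        then show ?thesis using \<open>r < s\<close> unfolding Ys by (simp add: l_def)
      qed simp
    qed
  qed
  then show ?thesis using ab unfolding P_def F_def by simp
qed

end

text \<open>One direction serves all points near \<open>x\<close>, so a whole piece of a curve can
  be pushed inside by a single translation, without altering its velocity.\<close>

definition inward_pushable :: "'a::real_normed_vector set \<Rightarrow> bool" where
  "inward_pushable W \<longleftrightarrow> (\<forall>x\<in>closure W. \<exists>d>0. \<exists>\<nu>. \<forall>\<delta>>0. \<delta> < d \<longrightarrow>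
     (\<forall>y\<in>closure W \<inter> ball x d. y + \<delta> *\<^sub>R \<nu> \<in> W))"

context quadratic_hamiltonian
begin

text \<open>Near each time the curve is translated by a small multiple of the inward direction, the
  estimate in the open set applies, and continuity of \<open>u\<close> up to the boundary removes
  the translation. Bolzano induction joins the short intervals.\<close>

lemma subsolution_along_curve:
  assumes sub: "interior_subsolution h W u" and W: "open W" "inward_pushable W"
    and cont: "continuous_on (closure W \<times> {0..}) (\<lambda>(x, t). u x t)"
    and ab: "0 \<le> a" "a \<le> b"
    and Y: "energy_curve Y dY a b" "\<And>r. r \<in> {a..b} \<Longrightarrow> Y r \<in> closure W"
    and \<Lambda>: "\<Lambda> integrable_on {a..b}" "\<And>r p. r \<in> {a..b} \<Longrightarrow> p \<bullet> dY r - h (Y r) p \<le> \<Lambda> r"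
  shows "u (Y b) b - u (Y a) a \<le> integral {a..b} \<Lambda>"
proof -
  define P where "P r s \<longleftrightarrow> (a \<le> r \<and> r \<le> s \<and> s \<le> b \<longrightarrow>
      u (Y s) s - u (Y r) r \<le> integral {r..s} \<Lambda>)" for r s
  have \<Lambda>_int: "\<Lambda> integrable_on {r..s}" if "a \<le> r" "s \<le> b" for r s
    using that by (intro integrable_on_subinterval[OF \<Lambda>(1)]) auto
  have Ycont: "continuous_on {a..b} Y" by (rule energy_curve_continuous_on[OF Y(1)])
  then have "bounded (Y ` {a..b})" by (intro compact_imp_bounded compact_continuous_image) auto
  then obtain B where B: "\<And>r. r \<in> {a..b} \<Longrightarrow> norm (Y r) \<le> B" unfolding bounded_iff by blast
  have contW: "continuous_on (W \<times> {0..}) (\<lambda>(x, t). u x t)"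
    using closure_subset by (intro continuous_on_subset[OF cont]) auto
  have "P a b"
    using \<open>a \<le> b\<close>
  proof (induction rule: Bolzano)
    case (trans r s q)
    show ?case
      unfolding P_def
    proof
      assume "a \<le> r \<and> r \<le> q \<and> q \<le> b"
      then have "integral {r..s} \<Lambda> + integral {s..q} \<Lambda> = integral {r..q} \<Lambda>"
        using trans by (intro Henstock_Kurzweil_Integration.integral_combine \<Lambda>_int) auto
      then show "u (Y q) q - u (Y r) r \<le> integral {r..q} \<Lambda>"
        using trans \<open>a \<le> r \<and> r \<le> q \<and> q \<le> b\<close> unfolding P_def by linarith
    qed
  next
    case (local x)
    then have "x \<in> {a..b}" by simp
    obtain d0 \<nu> where "d0 > 0" and \<nu>: "\<And>\<delta> y. 0 < \<delta> \<Longrightarrow> \<delta> < d0 \<Longrightarrow> y \<in> closure W \<Longrightarrow> y \<in> ball (Y x) d0 \<Longrightarrow>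
        y + \<delta> *\<^sub>R \<nu> \<in> W"
      using W(2) Y(2)[OF \<open>x \<in> {a..b}\<close>] unfolding inward_pushable_def by (metis IntI)
    have "continuous (at x within {a..b}) Y"
      using Ycont \<open>x \<in> {a..b}\<close> by (simp add: continuous_on_eq_continuous_within)
    then obtain d where "d > 0" and d: "\<And>r. r \<in> {a..b} \<Longrightarrow> dist r x < d \<Longrightarrow> dist (Y r) (Y x) < d0"
      using \<open>d0 > 0\<close> unfolding continuous_within_eps_delta by blast
    show ?case
      unfolding P_def
    proof (intro exI[of _ d] conjI allI impI \<open>d > 0\<close>)
      fix r s assume rs: "r \<le> x \<and> x \<le> s \<and> s - r < d" and bounds: "a \<le> r \<and> r \<le> s \<and> s \<le> b"
      have push: "Y q + \<delta> *\<^sub>R \<nu> \<in> W" if "q \<in> {r..s}" "0 < \<delta>" "\<delta> < d0" for q \<delta>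
      proof -
        have "q \<in> {a..b}" "dist q x < d" using that rs bounds by (auto simp: dist_real_def)
        then show ?thesis using that d[of q] Y(2)[of q] by (intro \<nu>) (auto simp: dist_commute)
      qed
      have lim: "((\<lambda>\<delta>. u (Y q + \<delta> *\<^sub>R \<nu>) q) \<longlongrightarrow> u (Y q) q) (at_right 0)" if q: "q \<in> {r..s}" for q
      proof -
        have "q \<in> {a..b}" using q bounds by auto
        have "((\<lambda>\<delta>. (\<lambda>(x, t). u x t) (Y q + \<delta> *\<^sub>R \<nu>, q)) \<longlongrightarrow> (\<lambda>(x, t). u x t) (Y q, q)) (at_right 0)"
        proof (rule continuous_within_tendsto_compose[where f = "\<lambda>(x, t). u x t" and a = "(Y q, q)"
              and x = "\<lambda>\<delta>. (Y q + \<delta> *\<^sub>R \<nu>, q)"])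
          show "continuous (at (Y q, q) within closure W \<times> {0..}) (\<lambda>(x, t). u x t)"
            using cont Y(2)[OF \<open>q \<in> {a..b}\<close>] q bounds ab by (auto simp: continuous_on_eq_continuous_within)
          show "\<forall>\<^sub>F \<delta> in at_right 0. (Y q + \<delta> *\<^sub>R \<nu>, q) \<in> closure W \<times> {0..}"
            unfolding eventually_at_right_field using \<open>d0 > 0\<close> push[OF q] closure_subset[of W] q bounds ab
            by (intro exI[of _ d0]) auto
          have "((\<lambda>\<delta>. (Y q + \<delta> *\<^sub>R \<nu>, q)) \<longlongrightarrow> (Y q + 0 *\<^sub>R \<nu>, q)) (at_right 0)"
            by (intro tendsto_intros)
          then show "((\<lambda>\<delta>. (Y q + \<delta> *\<^sub>R \<nu>, q)) \<longlongrightarrow> (Y q, q)) (at_right 0)" by simp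
        qed
        then show ?thesis by simp
      qed
      show "u (Y s) s - u (Y r) r \<le> integral {r..s} \<Lambda>"
      proof (rule field_le_epsilon)
        fix \<eta> :: real assume "\<eta> > 0"
        define E where "E = integral {r..s} (\<lambda>q. (norm (dY q))\<^sup>2)"
        have E_int: "(\<lambda>q. (norm (dY q))\<^sup>2) integrable_on {r..s}"
          using energy_curveD(2)[OF Y(1)] bounds by blast
        have "E \<ge> 0" unfolding E_def by (intro integral_nonneg E_int) auto
        \<comment> \<open>The error budget \<open>\<eta>\<close> is split evenly:
          \<open>\<kappa>\<close> controls the constant error over the interval, and a large
          threshold \<open>k\<close> controls the error proportional to the energy. The added 1
          keeps \<open>k\<close> positive when \<open>K * E = 0\<close>.\<close>
        define \<kappa> where "\<kappa> = \<eta> / (2 * (s - r + 1))"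
        define k where "k = sqrt (4 * K * E / \<eta> + 1)"
        have k2: "k\<^sup>2 = 4 * K * E / \<eta> + 1" and "k > 0" and "\<kappa> > 0"
          using K_nonneg \<open>E \<ge> 0\<close> \<open>\<eta> > 0\<close> bounds by (auto simp: k_def \<kappa>_def add_nonneg_pos)
        have small1: "(s - r) * \<kappa> \<le> \<eta> / 2" using \<open>\<eta> > 0\<close> bounds by (simp add: \<kappa>_def field_simps)
        have "4 * K * E \<le> \<eta> * k\<^sup>2" using \<open>\<eta> > 0\<close> by (simp add: k2 field_simps)
        then have small2: "2 * K / k\<^sup>2 * E \<le> \<eta> / 2" using \<open>k > 0\<close> by (simp add: field_simps)
        obtain \<delta>1 where "\<delta>1 > 0" and \<delta>1:
          "\<And>y y' v p l. y \<in> cball 0 (B + 1) \<Longrightarrow> y' \<in> cball 0 (B + 1) \<Longrightarrow> dist y y' < \<delta>1 \<Longrightarrow>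
             (\<And>q. q \<bullet> v - h y' q \<le> l) \<Longrightarrow> p \<bullet> v - h y p \<le> l + (\<kappa> + 2 * K / k\<^sup>2 * (norm v)\<^sup>2)"
          using legendre_perturbation[OF \<open>\<kappa> > 0\<close> \<open>k > 0\<close>] by blast
        define \<delta>2 where "\<delta>2 = min \<delta>1 1"
        have "\<delta>2 > 0" "\<delta>2 \<le> \<delta>1" "\<delta>2 \<le> 1" using \<open>\<delta>1 > 0\<close> by (auto simp: \<delta>2_def)
        have "\<forall>\<^sub>F \<delta> in at_right 0. norm (\<delta> *\<^sub>R \<nu>) < \<delta>2 / 3"
        proof -
          have "((\<lambda>\<delta>. norm (\<delta> *\<^sub>R \<nu>)) \<longlongrightarrow> norm (0 *\<^sub>R \<nu>)) (at_right 0)" by (intro tendsto_intros)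
          then show ?thesis by (rule order_tendstoD) (use \<open>\<delta>2 > 0\<close> in simp)
        qed
        moreover have "\<forall>\<^sub>F \<delta> in at_right 0. 0 < \<delta> \<and> \<delta> < d0"
          unfolding eventually_at_right_field using \<open>d0 > 0\<close> by blast
        ultimately have ev: "\<forall>\<^sub>F \<delta> in at_right 0. u (Y s + \<delta> *\<^sub>R \<nu>) s - u (Y r + \<delta> *\<^sub>R \<nu>) r
            \<le> integral {r..s} (\<lambda>q. \<Lambda> q + (\<kappa> + 2 * K / k\<^sup>2 * (norm (dY q))\<^sup>2))"
        proof eventually_elim
          case (elim \<delta>)
          show ?case
          proof (rule subsolution_along_shifted_curve[OF sub W(1) contW, where \<delta> = \<delta>2 and R = "B + 1"])
            show "0 \<le> r" "r \<le> s" using ab bounds by auto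
            show "energy_curve Y dY r s" using energy_curve_subinterval[OF Y(1)] bounds by blast
            show "\<Lambda> integrable_on {r..s}" using \<Lambda>_int bounds by blast
            show "p \<bullet> dY q - h (Y q) p \<le> \<Lambda> q" if "q \<in> {r..s}" for q p
              using \<Lambda>(2) that bounds by auto
            show "norm (Y q) + \<delta>2 \<le> B + 1" if "q \<in> {r..s}" for q
              using B[of q] \<open>\<delta>2 \<le> 1\<close> that bounds by auto
            show "Y q + \<delta> *\<^sub>R \<nu> \<in> W" if "q \<in> {r..s}" for q
              using push[OF that] elim by blast
            show "p \<bullet> v - h y p \<le> l + (\<kappa> + 2 * K / k\<^sup>2 * (norm v)\<^sup>2)"
              if "y \<in> cball 0 (B + 1)" "y' \<in> cball 0 (B + 1)" "dist y y' < \<delta>2"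
                "\<And>q. q \<bullet> v - h y' q \<le> l" for y y' v p l
              by (rule \<delta>1[OF that(1,2) order.strict_trans2[OF that(3) \<open>\<delta>2 \<le> \<delta>1\<close>] that(4)])
          qed (use \<open>\<delta>2 > 0\<close> elim in auto)
        qed
        \<comment> \<open>The right-hand side of \<open>ev\<close> does not depend on the
          translation, so the translation may tend to 0 while \<open>\<kappa>\<close> and
          \<open>k\<close> stay fixed.\<close>
        have "u (Y s) s - u (Y r) r \<le> integral {r..s} (\<lambda>q. \<Lambda> q + (\<kappa> + 2 * K / k\<^sup>2 * (norm (dY q))\<^sup>2))"
          using bounds
          by (intro tendsto_upperbound[OF tendsto_diff[OF lim[of s] lim[of r]] ev]) auto
        also have "\<dots> = integral {r..s} \<Lambda> + ((s - r) * \<kappa> + 2 * K / k\<^sup>2 * E)"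
        proof -
          have "((\<lambda>q. \<kappa>) has_integral ((s - r) * \<kappa>)) {r..s}"
            using has_integral_const_real[of \<kappa> r s] bounds by simp
          moreover have "(\<Lambda> has_integral (integral {r..s} \<Lambda>)) {r..s}"
            using \<Lambda>_int bounds by (intro integrable_integral) auto
          moreover have "((\<lambda>q. 2 * K / k\<^sup>2 * (norm (dY q))\<^sup>2) has_integral (2 * K / k\<^sup>2 * E)) {r..s}"
            unfolding E_def by (intro has_integral_mult_right integrable_integral E_int)
          ultimately show ?thesis by (intro integral_unique has_integral_add)
        qed
        finally show "u (Y s) s - u (Y r) r \<le> integral {r..s} \<Lambda> + \<eta>" using small1 small2 by linarith
      qed
    qed
  qed
  then show ?thesis using ab unfolding P_def by simp
qed

end

section \<open>Domains with a continuously differentiable boundary\<close>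

text \<open>Here \<open>\<rho>\<close> is the height above the boundary graph, measured along
  \<open>\<nu>\<close> and extended to the whole space. Its unit growth along \<open>\<nu>\<close>
  yields both the inward push and test functions of prescribed steepness.\<close>

definition locally_C1_superlevel :: "'a::euclidean_space set \<Rightarrow> bool" where
  "locally_C1_superlevel W \<longleftrightarrow>
     (\<forall>x0\<in>frontier W. \<exists>r>0. \<exists>\<nu> \<rho> D\<rho>. norm \<nu> = 1 \<and> C1_with_gradient \<rho> D\<rho> \<and>
        (\<forall>y. D\<rho> y \<bullet> \<nu> = 1) \<and> (\<forall>y \<delta>. \<rho> (y + \<delta> *\<^sub>R \<nu>) = \<rho> y + \<delta>) \<and>
        W \<inter> ball x0 r = {y \<in> ball x0 r. \<rho> y > 0})"

lemma C1_with_gradient_continuous_on: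
  assumes "C1_with_gradient f Df"
  shows "continuous_on S f"
proof (intro continuous_at_imp_continuous_on ballI)
  fix x
  have "(f has_derivative (\<lambda>k. k \<bullet> Df x)) (at x)"
    using assms by (simp add: C1_with_gradient_def gderiv_def)
  then show "isCont f x" by (rule has_derivative_continuous)
qed

text \<open>The map \<open>Q\<close> is the orthogonal projection onto the complement of
  \<open>\<nu>\<close>. It is self-adjoint, which turns the chain rule for the composition of
  \<open>\<psi>\<close> with \<open>Q\<close> into a gradient, and it annihilates
  \<open>\<nu>\<close>, which gives the unit growth.\<close>

lemma C1_boundary_imp_locally_C1_superlevel:
  assumes "C1_boundary \<Omega>"
  shows "locally_C1_superlevel \<Omega>"
  unfolding locally_C1_superlevel_def
proof
  fix x0 assume "x0 \<in> frontier \<Omega>"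
  then obtain r \<nu> \<psi> D\<psi> where "r > 0" and \<nu>: "norm \<nu> = 1" and \<psi>: "C1_with_gradient \<psi> D\<psi>"
    and eq: "\<Omega> \<inter> ball x0 r = {y \<in> ball x0 r. y \<bullet> \<nu> > \<psi> (y - (y \<bullet> \<nu>) *\<^sub>R \<nu>)}"
    using assms unfolding C1_boundary_def by meson
  have \<nu>1: "\<nu> \<bullet> \<nu> = 1" using \<nu> by (simp add: norm_eq_1)
  define Q where "Q y = y - (y \<bullet> \<nu>) *\<^sub>R \<nu>" for y
  define \<rho> where "\<rho> y = y \<bullet> \<nu> - \<psi> (Q y)" for y
  define D\<rho> where "D\<rho> y = \<nu> - Q (D\<psi> (Q y))" for y
  have Q_self_adjoint: "Q a \<bullet> c = a \<bullet> Q c" for a c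
    by (simp add: Q_def inner_diff inner_commute)
  have Q\<nu>: "Q (y + \<delta> *\<^sub>R \<nu>) = Q y" for y \<delta>
    by (simp add: Q_def \<nu>1 inner_add_left algebra_simps)
  have "C1_with_gradient \<rho> D\<rho>"
    unfolding C1_with_gradient_def
  proof (intro conjI allI)
    fix y
    have Q': "(Q has_derivative Q) (at y)"
      unfolding Q_def by (auto intro!: derivative_eq_intros)
    have "(\<psi> has_derivative (\<lambda>k. k \<bullet> D\<psi> (Q y))) (at (Q y))"
      using \<psi> by (simp add: C1_with_gradient_def gderiv_def)
    then have "((\<lambda>y. \<psi> (Q y)) has_derivative (\<lambda>k. Q k \<bullet> D\<psi> (Q y))) (at y)"
      using has_derivative_compose[OF Q'] by blast
    then have "(\<rho> has_derivative (\<lambda>k. k \<bullet> \<nu> - Q k \<bullet> D\<psi> (Q y))) (at y)"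
      unfolding \<rho>_def by (auto intro!: derivative_eq_intros)
    then show "GDERIV \<rho> y :> D\<rho> y"
      by (simp add: gderiv_def D\<rho>_def inner_diff_right Q_self_adjoint)
    have "continuous_on UNIV Q" unfolding Q_def by (intro continuous_intros)
    moreover have "continuous_on UNIV D\<psi>" using \<psi> by (simp add: C1_with_gradient_def)
    ultimately have "continuous_on UNIV (\<lambda>y. D\<psi> (Q y))"
      using continuous_on_compose2[of UNIV D\<psi> UNIV Q] by simp
    then show "continuous_on UNIV D\<rho>"
      unfolding D\<rho>_def Q_def[of "D\<psi> _"] by (intro continuous_intros)
  qed
  moreover have "D\<rho> y \<bullet> \<nu> = 1" for y
    using Q\<nu>[of 0 1] by (simp add: D\<rho>_def inner_diff_left Q_self_adjoint \<nu>1 Q_def)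
  moreover have "\<rho> (y + \<delta> *\<^sub>R \<nu>) = \<rho> y + \<delta>" for y \<delta>
    by (simp add: \<rho>_def Q\<nu> inner_add_left \<nu>1)
  moreover have "\<Omega> \<inter> ball x0 r = {y \<in> ball x0 r. \<rho> y > 0}"
    unfolding eq \<rho>_def Q_def by auto
  ultimately show "\<exists>r>0. \<exists>\<nu> \<rho> D\<rho>. norm \<nu> = 1 \<and> C1_with_gradient \<rho> D\<rho> \<and>
        (\<forall>y. D\<rho> y \<bullet> \<nu> = 1) \<and> (\<forall>y \<delta>. \<rho> (y + \<delta> *\<^sub>R \<nu>) = \<rho> y + \<delta>) \<and>
        \<Omega> \<inter> ball x0 r = {y \<in> ball x0 r. \<rho> y > 0}"
    using \<open>r > 0\<close> \<nu> by blast
qed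

lemma
  assumes "\<epsilon> > 0"
  shows open_scaled_domain: "open \<Omega> \<Longrightarrow> open (scaled_domain \<Omega> \<epsilon>)"
    and mem_scaled_domain: "x \<in> scaled_domain \<Omega> \<epsilon> \<longleftrightarrow> x /\<^sub>R \<epsilon> \<in> \<Omega>"
    and mem_closure_scaled_domain: "x \<in> closure (scaled_domain \<Omega> \<epsilon>) \<longleftrightarrow> x /\<^sub>R \<epsilon> \<in> closure \<Omega>"
    and mem_frontier_scaled_domain: "open \<Omega> \<Longrightarrow> x \<in> frontier (scaled_domain \<Omega> \<epsilon>) \<longleftrightarrow> x /\<^sub>R \<epsilon> \<in> frontier \<Omega>"
proof -
  have mem: "x \<in> (\<lambda>y. \<epsilon> *\<^sub>R y) ` S \<longleftrightarrow> x /\<^sub>R \<epsilon> \<in> S" for x :: "real^'n" and S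
    using assms by (auto simp: image_iff intro!: bexI[of _ "x /\<^sub>R \<epsilon>"])
  show op: "open (scaled_domain \<Omega> \<epsilon>)" if "open \<Omega>"
    using open_scaling[of \<epsilon> \<Omega>] that assms by (simp add: scaled_domain_def)
  show in_dom: "x \<in> scaled_domain \<Omega> \<epsilon> \<longleftrightarrow> x /\<^sub>R \<epsilon> \<in> \<Omega>" for x
    unfolding scaled_domain_def by (rule mem)
  have "closure (scaled_domain \<Omega> \<epsilon>) = (\<lambda>y. \<epsilon> *\<^sub>R y) ` closure \<Omega>"
    unfolding scaled_domain_def by (simp add: closure_scaleR)
  then show in_cl: "x \<in> closure (scaled_domain \<Omega> \<epsilon>) \<longleftrightarrow> x /\<^sub>R \<epsilon> \<in> closure \<Omega>" for x
    by (simp add: mem)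
  show "x \<in> frontier (scaled_domain \<Omega> \<epsilon>) \<longleftrightarrow> x /\<^sub>R \<epsilon> \<in> frontier \<Omega>" if "open \<Omega>"
    using op[OF that] that by (simp add: frontier_def interior_open in_cl in_dom)
qed

text \<open>The height is rescaled in both its argument and its value; the outer factor
  \<open>\<epsilon>\<close> preserves unit growth along \<open>\<nu>\<close>.\<close>

lemma locally_C1_superlevel_scaled_domain:
  assumes "\<epsilon> > 0" "open \<Omega>" "locally_C1_superlevel \<Omega>"
  shows "locally_C1_superlevel (scaled_domain \<Omega> \<epsilon>)"
  unfolding locally_C1_superlevel_def
proof
  fix x0 assume "x0 \<in> frontier (scaled_domain \<Omega> \<epsilon>)"
  then have "x0 /\<^sub>R \<epsilon> \<in> frontier \<Omega>" using assms by (simp add: mem_frontier_scaled_domain)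
  then obtain r \<nu> \<rho> D\<rho> where "r > 0" "norm \<nu> = 1" and \<rho>: "C1_with_gradient \<rho> D\<rho>"
      and D\<rho>: "\<And>y. D\<rho> y \<bullet> \<nu> = 1" and shift: "\<And>y \<delta>. \<rho> (y + \<delta> *\<^sub>R \<nu>) = \<rho> y + \<delta>"
      and eq: "\<Omega> \<inter> ball (x0 /\<^sub>R \<epsilon>) r = {y \<in> ball (x0 /\<^sub>R \<epsilon>) r. \<rho> y > 0}"
    using assms(3) unfolding locally_C1_superlevel_def by meson
  have in_ball: "y \<in> ball x0 (\<epsilon> * r) \<longleftrightarrow> y /\<^sub>R \<epsilon> \<in> ball (x0 /\<^sub>R \<epsilon>) r" for y
  proof -
    have "dist (x0 /\<^sub>R \<epsilon>) (y /\<^sub>R \<epsilon>) = dist x0 y / \<epsilon>"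
      using assms(1) by (simp add: dist_norm scaleR_diff_right[symmetric] divide_inverse mult.commute)
    then show ?thesis using assms(1) by (simp only: mem_ball pos_divide_less_eq mult.commute)
  qed
  show "\<exists>r>0. \<exists>\<nu> \<rho> D\<rho>. norm \<nu> = 1 \<and> C1_with_gradient \<rho> D\<rho> \<and>
      (\<forall>y. D\<rho> y \<bullet> \<nu> = 1) \<and> (\<forall>y \<delta>. \<rho> (y + \<delta> *\<^sub>R \<nu>) = \<rho> y + \<delta>) \<and>
      scaled_domain \<Omega> \<epsilon> \<inter> ball x0 r = {y \<in> ball x0 r. \<rho> y > 0}"
  proof (intro exI[of _ "\<epsilon> * r"] exI[of _ \<nu>] exI[of _ "\<lambda>y. \<epsilon> * \<rho> (y /\<^sub>R \<epsilon>)"]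
      exI[of _ "\<lambda>y. D\<rho> (y /\<^sub>R \<epsilon>)"] conjI allI)
    show "C1_with_gradient (\<lambda>y. \<epsilon> * \<rho> (y /\<^sub>R \<epsilon>)) (\<lambda>y. D\<rho> (y /\<^sub>R \<epsilon>))"
      unfolding C1_with_gradient_def
    proof (intro conjI allI)
      fix y
      have "(\<rho> has_derivative (\<lambda>k. k \<bullet> D\<rho> (y /\<^sub>R \<epsilon>))) (at (y /\<^sub>R \<epsilon>))"
        using \<rho> by (simp add: C1_with_gradient_def gderiv_def)
      moreover have "((\<lambda>y. y /\<^sub>R \<epsilon>) has_derivative (\<lambda>k. k /\<^sub>R \<epsilon>)) (at y)"
        by (auto intro!: derivative_eq_intros)
      ultimately have "((\<lambda>y. \<rho> (y /\<^sub>R \<epsilon>)) has_derivative (\<lambda>k. (k /\<^sub>R \<epsilon>) \<bullet> D\<rho> (y /\<^sub>R \<epsilon>))) (at y)"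
        using has_derivative_compose by blast
      then have "((\<lambda>y. \<epsilon> * \<rho> (y /\<^sub>R \<epsilon>)) has_derivative (\<lambda>k. \<epsilon> * ((k /\<^sub>R \<epsilon>) \<bullet> D\<rho> (y /\<^sub>R \<epsilon>)))) (at y)"
        by (rule has_derivative_mult_right)
      then show "GDERIV (\<lambda>y. \<epsilon> * \<rho> (y /\<^sub>R \<epsilon>)) y :> D\<rho> (y /\<^sub>R \<epsilon>)"
        using assms(1) by (simp add: gderiv_def mult.assoc[symmetric])
      have "continuous_on UNIV D\<rho>" using \<rho> by (simp add: C1_with_gradient_def)
      then show "continuous_on UNIV (\<lambda>y. D\<rho> (y /\<^sub>R \<epsilon>))"
        by (rule continuous_on_compose2[where f = "\<lambda>y. y /\<^sub>R \<epsilon>"]) (auto intro: continuous_intros)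
    qed
    show "\<epsilon> * \<rho> ((y + \<delta> *\<^sub>R \<nu>) /\<^sub>R \<epsilon>) = \<epsilon> * \<rho> (y /\<^sub>R \<epsilon>) + \<delta>" for y \<delta>
      using shift[of "y /\<^sub>R \<epsilon>" "\<delta> / \<epsilon>"] assms(1)
      by (simp add: scaleR_add_right divide_inverse mult.commute algebra_simps)
    show "scaled_domain \<Omega> \<epsilon> \<inter> ball x0 (\<epsilon> * r) = {y \<in> ball x0 (\<epsilon> * r). \<epsilon> * \<rho> (y /\<^sub>R \<epsilon>) > 0}"
    proof (rule set_eqI)
      fix y
      have "y /\<^sub>R \<epsilon> \<in> \<Omega> \<inter> ball (x0 /\<^sub>R \<epsilon>) r \<longleftrightarrow> y /\<^sub>R \<epsilon> \<in> {y \<in> ball (x0 /\<^sub>R \<epsilon>) r. \<rho> y > 0}"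
        by (simp only: eq)
      then show "y \<in> scaled_domain \<Omega> \<epsilon> \<inter> ball x0 (\<epsilon> * r) \<longleftrightarrow> y \<in> {y \<in> ball x0 (\<epsilon> * r). \<epsilon> * \<rho> (y /\<^sub>R \<epsilon>) > 0}"
        using assms(1) by (simp add: in_ball mem_scaled_domain zero_less_mult_iff del: mem_ball)
    qed
  qed (use \<open>r > 0\<close> \<open>norm \<nu> = 1\<close> D\<rho> assms in auto)
qed

lemma superlevel_closure_nonneg:
  fixes \<rho> :: "'a::real_normed_vector \<Rightarrow> real"
  assumes "W \<inter> ball x0 r = {y \<in> ball x0 r. \<rho> y > 0}" "continuous_on UNIV \<rho>"
    and y: "y \<in> closure W" "y \<in> ball x0 r"
  shows "0 \<le> \<rho> y"
proof (rule ccontr)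
  assume "\<not> 0 \<le> \<rho> y"
  define V where "V = ball x0 r \<inter> {y. \<rho> y < 0}"
  have "open V" unfolding V_def by (intro open_Int open_ball open_Collect_less assms continuous_intros)
  moreover have "y \<in> V" using y \<open>\<not> 0 \<le> \<rho> y\<close> by (auto simp: V_def)
  moreover have "V \<inter> W = {}" using assms(1) by (force simp: V_def)
  ultimately show False using y(1) open_Int_closure_eq_empty by blast
qed

text \<open>Near a boundary point the height is nonnegative on the closure, and a push by
  \<open>\<delta>\<close> raises it by \<open>\<delta>\<close>. Halving the radius keeps the pushed
  point in the chart.\<close>

lemma locally_C1_superlevel_imp_inward_pushable:
  assumes "open W" "locally_C1_superlevel W"
  shows "inward_pushable W"
  unfolding inward_pushable_def
proof
  fix x assume "x \<in> closure W"
  show "\<exists>d>0. \<exists>\<nu>. \<forall>\<delta>>0. \<delta> < d \<longrightarrow> (\<forall>y\<in>closure W \<inter> ball x d. y + \<delta> *\<^sub>R \<nu> \<in> W)"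
  proof (cases "x \<in> W")
    case True
    then obtain d where "d > 0" "ball x d \<subseteq> W" using assms(1) open_contains_ball by blast
    then show ?thesis by (intro exI[of _ d] conjI exI[of _ 0]) auto
  next
    case False
    then have "x \<in> frontier W" using \<open>x \<in> closure W\<close> assms(1) by (simp add: frontier_def interior_open)
    then obtain r \<nu> \<rho> D\<rho> where "r > 0" "norm \<nu> = 1" and \<rho>: "C1_with_gradient \<rho> D\<rho>"
      and shift: "\<And>y \<delta>. \<rho> (y + \<delta> *\<^sub>R \<nu>) = \<rho> y + \<delta>"
      and eq: "W \<inter> ball x r = {y \<in> ball x r. \<rho> y > 0}"
      using assms(2) unfolding locally_C1_superlevel_def by meson
    have "y + \<delta> *\<^sub>R \<nu> \<in> W" if "0 < \<delta>" "\<delta> < r / 2" "y \<in> closure W" "y \<in> ball x (r / 2)" for y \<delta>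
    proof -
      have "dist x (y + \<delta> *\<^sub>R \<nu>) \<le> dist x y + dist y (y + \<delta> *\<^sub>R \<nu>)" by (rule dist_triangle)
      also have "\<dots> < r" using that \<open>norm \<nu> = 1\<close> by (simp add: dist_norm[of y])
      finally have "y + \<delta> *\<^sub>R \<nu> \<in> ball x r" by simp
      moreover have "0 \<le> \<rho> y"
        using that \<open>r > 0\<close> by (intro superlevel_closure_nonneg[OF eq C1_with_gradient_continuous_on[OF \<rho>]]) auto
      then have "\<rho> (y + \<delta> *\<^sub>R \<nu>) > 0" using that by (simp add: shift)
      ultimately show ?thesis using eq by blast
    qed
    then show ?thesis using \<open>r > 0\<close> by (intro exI[of _ "r / 2"] conjI exI[of _ \<nu>]) auto
  qed
qed

section \<open>Consequences of the generalized Dirichlet condition for subsolutions\<close>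

lemma viscosity_subsolution_imp_interior:
  assumes "\<epsilon> > 0" "viscosity_subsolution H b \<Omega> \<epsilon> u"
  shows "interior_subsolution (\<lambda>x. H (x /\<^sub>R \<epsilon>)) (scaled_domain \<Omega> \<epsilon>) u"
  unfolding interior_subsolution_def
proof (intro ballI allI impI, elim conjE)
  fix x t \<phi> D\<phi> p q
  assume x: "x \<in> scaled_domain \<Omega> \<epsilon>" and "0 < t" and "C1_with_gradient \<phi> D\<phi>" "D\<phi> (x, t) = (p, q)"
    and ev: "\<forall>\<^sub>F (y, s) in nhds (x, t). u y s - \<phi> (y, s) \<le> u x t - \<phi> (x, t)"
  moreover have "x \<in> closure (scaled_domain \<Omega> \<epsilon>)" using x closure_subset by blast
  moreover have "\<forall>\<^sub>F (y, s) in at (x, t) within closure (scaled_domain \<Omega> \<epsilon>) \<times> {0<..}.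
      u y s - \<phi> (y, s) \<le> u x t - \<phi> (x, t)"
    using ev unfolding eventually_at_filter by (rule eventually_mono) simp
  ultimately show "q + H (x /\<^sub>R \<epsilon>) p \<le> 0"
    using assms(2) unfolding viscosity_subsolution_def Let_def by blast
qed

text \<open>Coercivity: at a boundary point where \<open>u > b\<close> the subsolution would satisfy the equation up
  to the boundary, which is violated by test functions with a steep gradient pointing inwards.\<close>

lemma viscosity_subsolution_le_bdry_data:
  fixes \<Omega> :: "(real^'n) set"
  assumes \<epsilon>: "\<epsilon> > 0" and \<Omega>: "open \<Omega>" and W: "locally_C1_superlevel (scaled_domain \<Omega> \<epsilon>)"
    and h: "quadratic_hamiltonian (\<lambda>x. H (x /\<^sub>R \<epsilon>)) K"
    and sub: "viscosity_subsolution H b \<Omega> \<epsilon> u"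
    and u: "continuous_on (closure (scaled_domain \<Omega> \<epsilon>) \<times> {0..}) (\<lambda>(x, t). u x t)"
    and b: "continuous_on (UNIV \<times> frontier \<Omega>) (\<lambda>(x, y). b x y)"
    and x0: "x0 \<in> frontier (scaled_domain \<Omega> \<epsilon>)" and "t0 > 0"
  shows "u x0 t0 \<le> b x0 (x0 /\<^sub>R \<epsilon>)"
proof (rule ccontr)
  interpret quadratic_hamiltonian "\<lambda>x. H (x /\<^sub>R \<epsilon>)" K by (rule h)
  define W where "W = scaled_domain \<Omega> \<epsilon>"
  have "open W" unfolding W_def by (rule open_scaled_domain[OF \<epsilon> \<Omega>])
  assume "\<not> u x0 t0 \<le> b x0 (x0 /\<^sub>R \<epsilon>)"
  then have w0: "0 < u x0 t0 - b x0 (x0 /\<^sub>R \<epsilon>)" by simp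
  have frontier_sub: "frontier W \<subseteq> closure W" by (simp add: frontier_def)
  have "continuous_on (frontier W \<times> {0..}) (\<lambda>(x, t). u x t - b x (x /\<^sub>R \<epsilon>))"
  proof -
    have "continuous_on (frontier W \<times> {0..}) (\<lambda>(x, t). u x t)"
      using frontier_sub u unfolding W_def by (intro continuous_on_subset[OF u]) auto
    moreover have "continuous_on (frontier W \<times> {0..}) ((\<lambda>(x, y). b x y) \<circ> (\<lambda>w. (fst w, fst w /\<^sub>R \<epsilon>)))"
      using \<epsilon> \<Omega> unfolding W_def
      by (intro continuous_on_compose continuous_on_subset[OF b] continuous_intros)
        (auto simp: mem_frontier_scaled_domain)
    ultimately show ?thesis
      unfolding split_def by (intro continuous_on_diff) (simp_all add: o_def)
  qed
  moreover have "(x0, t0) \<in> frontier W \<times> {0..}" using x0 \<open>t0 > 0\<close> by (simp add: W_def)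
  ultimately obtain d where "d > 0" and d: "\<And>x t. x \<in> frontier W \<Longrightarrow> t \<ge> 0 \<Longrightarrow> dist (x, t) (x0, t0) < d \<Longrightarrow>
      0 < u x t - b x (x /\<^sub>R \<epsilon>)"
  proof -
    assume "continuous_on (frontier W \<times> {0..}) (\<lambda>(x, t). u x t - b x (x /\<^sub>R \<epsilon>))"
      "(x0, t0) \<in> frontier W \<times> {0..}"
    then obtain d where "d > 0" and d: "\<And>w. w \<in> frontier W \<times> {0..} \<Longrightarrow> dist w (x0, t0) < d \<Longrightarrow>
        dist ((\<lambda>(x, t). u x t - b x (x /\<^sub>R \<epsilon>)) w) ((\<lambda>(x, t). u x t - b x (x /\<^sub>R \<epsilon>)) (x0, t0))
          < u x0 t0 - b x0 (x0 /\<^sub>R \<epsilon>)"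
      using w0 unfolding continuous_on_iff by blast
    have "0 < u x t - b x (x /\<^sub>R \<epsilon>)" if "x \<in> frontier W" "t \<ge> 0" "dist (x, t) (x0, t0) < d" for x t
      using d[of "(x, t)"] that by (simp add: dist_real_def abs_less_iff)
    then show ?thesis using \<open>d > 0\<close> that by blast
  qed
  obtain r \<nu> \<rho> D\<rho> where "r > 0" "norm \<nu> = 1" and \<rho>: "C1_with_gradient \<rho> D\<rho>"
      and D\<rho>: "\<And>y. D\<rho> y \<bullet> \<nu> = 1" and eq: "W \<inter> ball x0 r = {y \<in> ball x0 r. \<rho> y > 0}"
    using W x0 unfolding locally_C1_superlevel_def W_def by meson
  have \<rho>_cont: "continuous_on S \<rho>" for S by (rule C1_with_gradient_continuous_on[OF \<rho>])
  have \<rho>_nonneg: "0 \<le> \<rho> y" if "y \<in> closure W" "y \<in> ball x0 r" for y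
    by (rule superlevel_closure_nonneg[OF eq \<rho>_cont that])
  have "\<rho> x0 = 0"
  proof (rule antisym)
    have "x0 \<notin> W" using x0 \<open>open W\<close> by (simp add: frontier_def interior_open W_def)
    then show "\<rho> x0 \<le> 0" using eq \<open>r > 0\<close> by force
    show "0 \<le> \<rho> x0" using x0 frontier_sub \<open>r > 0\<close> by (intro \<rho>_nonneg) (auto simp: W_def)
  qed
  \<comment> \<open>Within this radius the boundary chart is valid, times are positive, and
    \<open>u > b\<close> persists on the lateral boundary.\<close>
  define r2 where "r2 = min (min r t0) d / 2"
  have r2: "r2 > 0" "r2 < r" "r2 < t0" "r2 < d"
    using \<open>r > 0\<close> \<open>t0 > 0\<close> \<open>d > 0\<close> by (auto simp: r2_def)
  define C where "C = (closure W \<times> {0..}) \<inter> cball (x0, t0) r2"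
  have "compact C" unfolding C_def by (intro closed_Int_compact closed_Times) auto
  have uC: "continuous_on C (\<lambda>(x, t). u x t)"
    using u by (intro continuous_on_subset[OF u]) (auto simp: C_def W_def)
  then have "bounded ((\<lambda>(x, t). u x t) ` C)" by (intro compact_imp_bounded compact_continuous_image \<open>compact C\<close>)
  then obtain M where M: "\<And>y s. (y, s) \<in> C \<Longrightarrow> \<bar>u y s\<bar> \<le> M" unfolding bounded_iff by fastforce
  have x0C: "(x0, t0) \<in> C" using x0 frontier_sub \<open>t0 > 0\<close> r2 by (auto simp: C_def W_def)
  have "M \<ge> 0" using M[OF x0C] by simp
  \<comment> \<open>The localizing penalty beats the oscillation of \<open>u\<close> on the sphere
    of radius \<open>r2\<close>. It is fixed before the steepness \<open>\<kappa>\<close>: on the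
    closure \<open>\<rho>\<close> is nonnegative, and it vanishes at \<open>x0\<close>, so the steep
    term cannot move the maximum to that sphere.\<close>
  define N where "N = (2 * M + 1) / r2\<^sup>2"
  have "N > 0" using \<open>M \<ge> 0\<close> r2 by (simp add: N_def)
  define L where "L = 2 * N * r2"
  have "L > 0" using \<open>N > 0\<close> r2 by (simp add: L_def)
  \<comment> \<open>\<open>L\<close> bounds the time derivative and the component of the penalty
    gradient along \<open>\<nu>\<close>. One \<open>L\<close> compensates the latter; the remaining
    \<open>K + L + 2\<close> makes the Hamiltonian dominate the time derivative.\<close>
  define \<kappa> where "\<kappa> = L + (K + L + 2)"
  have "\<kappa> > 0" using \<open>L > 0\<close> K_nonneg by (simp add: \<kappa>_def)
  define \<phi> where "\<phi> w = \<kappa> * \<rho> (fst w) + N * ((fst w - x0) \<bullet> (fst w - x0) + (snd w - t0)\<^sup>2)" for w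
  define D\<phi> where "D\<phi> w = (\<kappa> *\<^sub>R D\<rho> (fst w) + (2 * N) *\<^sub>R (fst w - x0), 2 * N * (snd w - t0))" for w
  have C1: "C1_with_gradient \<phi> D\<phi>"
    unfolding C1_with_gradient_def gderiv_def
  proof (intro conjI allI)
    fix w :: "(real^'n) \<times> real"
    have "(\<rho> has_derivative (\<lambda>k. k \<bullet> D\<rho> (fst w))) (at (fst w))"
      using \<rho> by (simp add: C1_with_gradient_def gderiv_def)
    moreover have "(fst has_derivative fst) (at w)" by (auto intro!: derivative_eq_intros)
    ultimately have "((\<lambda>w. \<rho> (fst w)) has_derivative (\<lambda>k. fst k \<bullet> D\<rho> (fst w))) (at w)"
      using has_derivative_compose[of fst fst w UNIV \<rho>] by blast
    then show "(\<phi> has_derivative (\<lambda>k. k \<bullet> D\<phi> w)) (at w)"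
      unfolding \<phi>_def D\<phi>_def
      by (auto intro!: derivative_eq_intros simp: inner_prod_def inner_add_right inner_commute algebra_simps)
    have "continuous_on UNIV D\<rho>" using \<rho> by (simp add: C1_with_gradient_def)
    then have "continuous_on UNIV (\<lambda>w::((real^'n) \<times> real). D\<rho> (fst w))"
      using continuous_on_compose2[of UNIV D\<rho> UNIV fst] by (simp add: continuous_on_fst)
    then show "continuous_on UNIV D\<phi>"
      unfolding D\<phi>_def by (intro continuous_intros)
  qed
  have "continuous_on C (\<lambda>w. (\<lambda>(x, t). u x t) w - \<phi> w)"
    using uC C1_with_gradient_continuous_on[OF C1] by (intro continuous_on_diff)
  then obtain w where "w \<in> C" and w: "\<And>w'. w' \<in> C \<Longrightarrow> (\<lambda>(x, t). u x t) w' - \<phi> w' \<le> (\<lambda>(x, t). u x t) w - \<phi> w"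
    using continuous_attains_sup[OF \<open>compact C\<close>] x0C by blast
  obtain y s where ys: "w = (y, s)" by (cases w)
  have yC: "(y, s) \<in> C" using \<open>w \<in> C\<close> ys by simp
  have max: "u y' s' - \<phi> (y', s') \<le> u y s - \<phi> (y, s)" if "(y', s') \<in> C" for y' s'
    using w[OF that] by (simp add: ys)
  have dist2: "(y - x0) \<bullet> (y - x0) + (s - t0)\<^sup>2 = (dist (y, s) (x0, t0))\<^sup>2"
    by (simp add: dist_Pair_Pair dist_norm power2_norm_eq_inner dist_real_def)
      (simp add: power2_eq_square)
  have le: "dist y x0 \<le> dist (y, s) (x0, t0)" "\<bar>s - t0\<bar> \<le> dist (y, s) (x0, t0)"
    using dist_fst_le[of "(y, s)" "(x0, t0)"] dist_snd_le[of "(y, s)" "(x0, t0)"] by (auto simp: dist_real_def)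
  have in_C: "y \<in> closure W" "0 \<le> s" "dist (y, s) (x0, t0) \<le> r2"
    using yC by (auto simp: C_def dist_commute)
  have "dist (y, s) (x0, t0) \<noteq> r2"
  proof
    assume "dist (y, s) (x0, t0) = r2"
    then have "N * ((y - x0) \<bullet> (y - x0) + (s - t0)\<^sup>2) = 2 * M + 1"
      unfolding dist2 using r2 by (simp add: N_def)
    moreover have "0 \<le> \<kappa> * \<rho> y"
      using \<rho>_nonneg[of y] in_C le r2 \<open>\<kappa> > 0\<close> by (simp add: dist_commute)
    ultimately have "u y s - \<phi> (y, s) \<le> M - (2 * M + 1)"
      using M[OF yC] by (simp add: \<phi>_def)
    moreover have "u x0 t0 \<le> u y s - \<phi> (y, s)"
      using max[OF x0C] by (simp add: \<phi>_def \<open>\<rho> x0 = 0\<close>)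
    ultimately show False using M[OF x0C] by linarith
  qed
  then have close: "dist (y, s) (x0, t0) < r2" using in_C by simp
  have "s > 0" using le(2) close r2 by linarith
  define p where "p = \<kappa> *\<^sub>R D\<rho> y + (2 * N) *\<^sub>R (y - x0)"
  define q where "q = 2 * N * (s - t0)"
  have "\<forall>\<^sub>F (y', s') in at (y, s) within closure W \<times> {0<..}. u y' s' - \<phi> (y', s') \<le> u y s - \<phi> (y, s)"
    unfolding eventually_at_filter eventually_nhds
  proof (intro exI[of _ "ball (x0, t0) r2"] conjI ballI impI)
    show "(y, s) \<in> ball (x0, t0) r2" using close by (simp add: dist_commute)
    fix w' assume "w' \<in> ball (x0, t0) r2" "w' \<noteq> (y, s)" "w' \<in> closure W \<times> {0<..}"
    then show "case w' of (y', s') \<Rightarrow> u y' s' - \<phi> (y', s') \<le> u y s - \<phi> (y, s)"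
      using max by (cases w') (auto simp: C_def)
  qed simp
  moreover have "D\<phi> (y, s) = (p, q)" by (simp add: D\<phi>_def p_def q_def)
  ultimately have "(y \<in> W \<longrightarrow> q + H (y /\<^sub>R \<epsilon>) p \<le> 0) \<and>
      (y \<in> frontier W \<longrightarrow> min (q + H (y /\<^sub>R \<epsilon>) p) (u y s - b y (y /\<^sub>R \<epsilon>)) \<le> 0)"
    using sub \<open>s > 0\<close> C1 in_C(1) unfolding viscosity_subsolution_def Let_def W_def by blast
  moreover have "0 < u y s - b y (y /\<^sub>R \<epsilon>)" if "y \<in> frontier W"
    using d[OF that] \<open>s > 0\<close> close r2 by simp
  moreover have "y \<in> W \<or> y \<in> frontier W"
    using in_C(1) \<open>open W\<close> by (simp add: frontier_def interior_open)
  \<comment> \<open>At a boundary maximum \<open>u > b\<close> excludes the second entry of the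
    minimum, so the equation holds there too.\<close>
  ultimately have le0: "q + H (y /\<^sub>R \<epsilon>) p \<le> 0" by (auto simp: min_le_iff_disj)
  have "\<bar>(2 * N) *\<^sub>R (y - x0) \<bullet> \<nu>\<bar> \<le> L"
  proof -
    have "\<bar>(y - x0) \<bullet> \<nu>\<bar> \<le> r2"
      using Cauchy_Schwarz_ineq2[of "y - x0" \<nu>] \<open>norm \<nu> = 1\<close> le(1) close by (simp add: dist_norm)
    then show ?thesis using \<open>N > 0\<close> by (simp add: L_def abs_mult)
  qed
  then have "K + L + 2 \<le> p \<bullet> \<nu>"
    using D\<rho>[of y] by (simp add: p_def inner_add_left \<kappa>_def)
  also have "\<dots> \<le> norm p" using norm_cauchy_schwarz[of p \<nu>] \<open>norm \<nu> = 1\<close> by simp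
  finally have "(K + L + 2)\<^sup>2 \<le> (norm p)\<^sup>2" using K_nonneg \<open>L > 0\<close> by (intro power_mono) auto
  moreover have "(K + L + 2)\<^sup>2 = (K + L)\<^sup>2 + 4 * (K + L) + 4" by (simp add: power2_eq_square algebra_simps)
  ultimately have big: "2 * (K + L) + 2 \<le> (norm p)\<^sup>2 / 2"
    using zero_le_power2[of "K + L"] by linarith
  have "\<bar>q\<bar> \<le> L"
  proof -
    have "\<bar>q\<bar> = 2 * N * \<bar>s - t0\<bar>" using \<open>N > 0\<close> by (simp add: q_def abs_mult)
    also have "\<dots> \<le> L" unfolding L_def using \<open>N > 0\<close> le(2) close by (intro mult_left_mono) auto
    finally show ?thesis .
  qed
  have "(norm p)\<^sup>2 / 2 - K \<le> H (y /\<^sub>R \<epsilon>) p" using h_lower[of p y] by simp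
  with big have "K + 2 * L + 2 \<le> H (y /\<^sub>R \<epsilon>) p" by argo
  moreover have "- L \<le> q" using \<open>\<bar>q\<bar> \<le> L\<close> by linarith
  ultimately show False using le0 K_nonneg \<open>L > 0\<close> by linarith
qed

section \<open>Speed of minimizers\<close>

lemma has_integral_affine_real:
  fixes f :: "real \<Rightarrow> 'b::real_normed_vector"
  assumes "(f has_integral i) {m * r + c..m * s + c}" "m > 0"
  shows "((\<lambda>x. f (m * x + c)) has_integral (i /\<^sub>R m)) {r..s}"
proof -
  have "(m * x + c - c) /\<^sub>R m = x" for x using assms(2) by (simp add: field_simps)
  then show ?thesis
    using has_integral_affinity'[OF assms(1)[folded box_real] assms(2), of c]
    unfolding \<open>\<And>x. (m * x + c - c) /\<^sub>R m = x\<close> box_real by simp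
qed

lemma energy_curve_affine:
  assumes Y: "energy_curve Y dY (m * a + c) (m * b + c)" and "m > 0"
  shows "energy_curve (\<lambda>r. Y (m * r + c)) (\<lambda>r. m *\<^sub>R dY (m * r + c)) a b"
  unfolding energy_curve_def
proof (intro conjI allI impI)
  fix r s assume "a \<le> r \<and> r \<le> s \<and> s \<le> b"
  then have "(dY has_integral (Y (m * s + c) - Y (m * r + c))) {m * r + c..m * s + c}"
    using \<open>m > 0\<close> by (intro energy_curveD(1)[OF Y]) auto
  from has_integral_cmul[OF has_integral_affine_real[OF this \<open>m > 0\<close>], of m]
  show "((\<lambda>r. m *\<^sub>R dY (m * r + c)) has_integral (Y (m * s + c) - Y (m * r + c))) {r..s}"
    using \<open>m > 0\<close> by simp
next
  have "(\<lambda>r. (norm (dY r))\<^sup>2) integrable_on {m * a + c..m * b + c}"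
    using Y by (simp add: energy_curve_def)
  then obtain i where "((\<lambda>r. (norm (dY r))\<^sup>2) has_integral i) {m * a + c..m * b + c}"
    by (auto simp: integrable_on_def)
  from has_integral_mult_right[OF has_integral_affine_real[OF this \<open>m > 0\<close>], of "m\<^sup>2"]
  show "(\<lambda>r. (norm (m *\<^sub>R dY (m * r + c)))\<^sup>2) integrable_on {a..b}"
    by (auto simp: integrable_on_def power_mult_distrib)
qed

text \<open>The inequality \<open>2 * c * x \<le> x\<^sup>2 + c\<^sup>2\<close> for the speed
  \<open>x\<close>, integrated in time. The free parameter is used with the modulus of
  \<open>G\<close>, to absorb the displacement of the initial point, and with the final speed
  bound.\<close>

lemma energy_curve_displacement:
  assumes Y: "energy_curve Y dY r s" "r \<le> s" and "c \<ge> 0"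
  shows "2 * c * norm (Y s - Y r) \<le> integral {r..s} (\<lambda>q. (norm (dY q))\<^sup>2) + c\<^sup>2 * (s - r)"
proof -
  have E: "(\<lambda>q. (norm (dY q))\<^sup>2) integrable_on {r..s}" using Y(1) by (simp add: energy_curve_def)
  have dY: "((\<lambda>q. (2 * c) *\<^sub>R dY q) has_integral ((2 * c) *\<^sub>R (Y s - Y r))) {r..s}"
    using energy_curveD(1)[OF Y(1)] Y(2) by (intro has_integral_cmul) auto
  have sum: "((\<lambda>q. (norm (dY q))\<^sup>2 + c\<^sup>2) has_integral
      (integral {r..s} (\<lambda>q. (norm (dY q))\<^sup>2) + c\<^sup>2 * (s - r))) {r..s}"
    using has_integral_const_real[of "c\<^sup>2" r s] Y(2)
    by (intro has_integral_add integrable_integral E) (simp add: mult.commute)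
  have "norm (integral {r..s} (\<lambda>q. (2 * c) *\<^sub>R dY q)) \<le> integral {r..s} (\<lambda>q. (norm (dY q))\<^sup>2 + c\<^sup>2)"
  proof (rule integral_norm_bound_integral)
    show "norm ((2 * c) *\<^sub>R dY q) \<le> (norm (dY q))\<^sup>2 + c\<^sup>2" for q
      using sum_squares_bound[of "norm (dY q)" c] \<open>c \<ge> 0\<close> by (simp add: algebra_simps)
  qed (use dY sum in \<open>auto simp: integrable_on_def\<close>)
  then show ?thesis
    unfolding integral_unique[OF dY] integral_unique[OF sum] using \<open>c \<ge> 0\<close> by simp
qed

context quadratic_hamiltonian
begin

text \<open>\<open>F\<close> stands for the boundary or initial value at the starting point. The
  conditions on \<open>s - r\<close> keep the competitors at admissible times: the backward shift
  must neither move a lateral starting point to time zero or earlier, nor put \<open>r\<close>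
  before time zero.\<close>

lemma minimizer_displacement:
  assumes sub: "interior_subsolution h W u" and W: "open W" "inward_pushable W"
    and cont: "continuous_on (closure W \<times> {0..}) (\<lambda>(x, t). u x t)"
    and \<tau>: "0 \<le> \<tau>" "\<tau> < t"
    and X: "energy_curve X dX \<tau> t" "\<And>r. r \<in> {\<tau>..t} \<Longrightarrow> X r \<in> closure W"
    and \<Lambda>: "\<Lambda> integrable_on {\<tau>..t}" "\<And>r p. r \<in> {\<tau>..t} \<Longrightarrow> p \<bullet> dX r - h (X r) p \<le> \<Lambda> r"
    and opt: "u (X t) t = integral {\<tau>..t} \<Lambda> + F"
    and lateral: "\<And>r. 0 < r \<Longrightarrow> r \<le> \<tau> \<Longrightarrow> u (X \<tau>) r \<le> F"
    and initial: "\<tau> = 0 \<Longrightarrow> u (X 0) 0 = F" "\<And>x. \<tau> = 0 \<Longrightarrow> x \<in> closure W \<Longrightarrow> u x 0 - u (X 0) 0 \<le> G * norm (x - X 0)"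
    and K: "K > 0"
    and rs: "\<tau> < r" "r < s" "s \<le> t" "0 < \<tau> \<Longrightarrow> s - r < \<tau>" "s - r \<le> r"
  shows "norm (X s - X r) \<le> sqrt (16 * K + 2 * G\<^sup>2) * (s - r)"
proof -
  define C where "C = G\<^sup>2 / 2 + K"
  have "C \<ge> 0" using K by (simp add: C_def)
  have \<Lambda>_int: "\<Lambda> integrable_on {a..b}" if "\<tau> \<le> a" "b \<le> t" for a b
    using that by (intro integrable_on_subinterval[OF \<Lambda>(1)]) auto
  have \<Lambda>_add: "integral {a..b} \<Lambda> + integral {b..c} \<Lambda> = integral {a..c} \<Lambda>"
    if "\<tau> \<le> a" "a \<le> b" "b \<le> c" "c \<le> t" for a b c
    using that by (intro Henstock_Kurzweil_Integration.integral_combine \<Lambda>_int) auto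
  have X_sub: "energy_curve X dX a b" if "\<tau> \<le> a" "b \<le> t" for a b
    using energy_curve_subinterval[OF X(1)] that by blast
  have along: "u (X b) b - u (X a) a \<le> integral {a..b} \<Lambda>" if "\<tau> \<le> a" "a \<le> b" "b \<le> t" for a b
  proof (rule subsolution_along_curve[OF sub W cont])
    show "energy_curve X dX a b" "\<Lambda> integrable_on {a..b}" using X_sub \<Lambda>_int that by auto
  qed (use X(2) \<Lambda>(2) that \<tau> in auto)
  have start: "u (X \<tau>) \<tau> \<le> F" using lateral[of \<tau>] initial(1) \<tau> by fastforce
  \<comment> \<open>The increment inequalities on both sides of \<open>q\<close> add up to the total
    cost, which \<open>opt\<close> says is attained, so neither can be strict.\<close>
  have u_X: "u (X q) q = F + integral {\<tau>..q} \<Lambda>" if "\<tau> \<le> q" "q \<le> t" for q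
    using along[of \<tau> q] along[of q t] \<Lambda>_add[of \<tau> q t] start opt that by linarith
  have increment: "u (X b) b - u (X a) a = integral {a..b} \<Lambda>" if "\<tau> \<le> a" "a \<le> b" "b \<le> t" for a b
    using u_X[of a] u_X[of b] \<Lambda>_add[of \<tau> a b] that by linarith
  define E where "E a b = integral {a..b} (\<lambda>q. (norm (dX q))\<^sup>2)" for a b
  have E_int: "((\<lambda>q. (norm (dX q))\<^sup>2) has_integral E a b) {a..b}" if "\<tau> \<le> a" "a \<le> b" "b \<le> t" for a b
    unfolding E_def using energy_curveD(2)[OF X(1)] that by (intro integrable_integral) blast
  have \<Lambda>_low: "E a b / 2 - K * (b - a) \<le> integral {a..b} \<Lambda>" if "\<tau> \<le> a" "a \<le> b" "b \<le> t" for a b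
  proof -
    have "((\<lambda>q. (norm (dX q))\<^sup>2 / 2) has_integral (E a b / 2)) {a..b}"
      by (intro has_integral_divide E_int that)
    moreover have "((\<lambda>q. K) has_integral (K * (b - a))) {a..b}"
      using has_integral_const_real[of K a b] that by (simp add: mult.commute)
    ultimately have "((\<lambda>q. (norm (dX q))\<^sup>2 / 2 - K) has_integral (E a b / 2 - K * (b - a))) {a..b}"
      by (rule has_integral_diff)
    then show ?thesis
    proof (rule has_integral_le[OF _ integrable_integral])
      show "\<Lambda> integrable_on {a..b}" using \<Lambda>_int that by blast
      show "(norm (dX q))\<^sup>2 / 2 - K \<le> \<Lambda> q" if "q \<in> {a..b}" for q
        using that \<open>\<tau> \<le> a\<close> \<open>b \<le> t\<close> by (intro legendre_lower[OF \<Lambda>(2)]) auto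
    qed
  qed
  define k where "k = s - r"
  have k: "0 < k" "k \<le> r" "0 < \<tau> \<Longrightarrow> k < \<tau>" using rs by (auto simp: k_def)
  have shifted: "u (X r) (r - k) - u (X a) (a - k) \<le> integral {a..r} \<Lambda>"
    if a: "\<tau> \<le> a" "k \<le> a" "a \<le> r" for a
  proof -
    have int: "((\<lambda>q. \<Lambda> (1 * q + k)) has_integral (integral {a..r} \<Lambda> /\<^sub>R 1)) {a - k..r - k}"
      using \<Lambda>_int a rs by (intro has_integral_affine_real) (auto intro: integrable_integral)
    have "u (X (1 * (r - k) + k)) (r - k) - u (X (1 * (a - k) + k)) (a - k)
        \<le> integral {a - k..r - k} (\<lambda>q. \<Lambda> (1 * q + k))"
    proof (rule subsolution_along_curve[OF sub W cont])
      show "energy_curve (\<lambda>q. X (1 * q + k)) (\<lambda>q. 1 *\<^sub>R dX (1 * q + k)) (a - k) (r - k)"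
        using X_sub a rs by (intro energy_curve_affine) auto
      show "(\<lambda>q. \<Lambda> (1 * q + k)) integrable_on {a - k..r - k}" using int by (auto simp: integrable_on_def)
      show "p \<bullet> 1 *\<^sub>R dX (1 * q + k) - h (X (1 * q + k)) p \<le> \<Lambda> (1 * q + k)" if "q \<in> {a - k..r - k}" for q p
        using \<Lambda>(2)[of "q + k" p] that a rs by simp
    qed (use X(2) a rs in auto)
    then show ?thesis using integral_unique[OF int] by simp
  qed
  text \<open>Competitor: shift the minimizer
    back in time and, if it started at time zero, cut off its initial piece.\<close>
  have time_shift: "u (X r) (r - k) \<le> u (X r) r + C * k"
  proof (cases "\<tau> = 0")
    case False
    then have "u (X r) (r - k) - u (X \<tau>) (\<tau> - k) \<le> u (X r) r - F"
      using shifted[of \<tau>] u_X[of r] k \<tau> rs by simp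
    moreover have "u (X \<tau>) (\<tau> - k) \<le> F" using False \<tau> k by (intro lateral) auto
    moreover have "0 \<le> C * k" using \<open>C \<ge> 0\<close> k by simp
    ultimately show ?thesis by linarith
  next
    case True
    have kt: "\<tau> \<le> 0" "0 \<le> k" "k \<le> t" using True k rs by auto
    have "u (X r) (r - k) - u (X k) 0 \<le> u (X r) r - u (X k) k"
      using shifted[of k] increment[of k r] True k rs by simp
    moreover have "u (X k) k = F + integral {0..k} \<Lambda>" using u_X[of k] True kt by simp
    moreover have "E 0 k / 2 - K * k \<le> integral {0..k} \<Lambda>" using \<Lambda>_low[of 0 k] kt True by simp
    moreover have "u (X k) 0 - F \<le> G * norm (X k - X 0)"
      using initial True X(2)[of k] kt by auto
    \<comment> \<open>No sign of \<open>G\<close> is assumed, hence its modulus. The energy on the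
      right cancels against the lower bound for the cost of the omitted piece.\<close>
    moreover have "2 * (G * norm (X k - X 0)) \<le> E 0 k + G\<^sup>2 * k"
    proof -
      have "2 * \<bar>G\<bar> * norm (X k - X 0) \<le> E 0 k + \<bar>G\<bar>\<^sup>2 * (k - 0)"
        unfolding E_def using X_sub[of 0 k] kt by (intro energy_curve_displacement) (auto simp: True)
      moreover have "2 * (G * norm (X k - X 0)) \<le> 2 * \<bar>G\<bar> * norm (X k - X 0)"
        by (simp add: mult_right_mono)
      ultimately show ?thesis by simp
    qed
    moreover have "C * k = G\<^sup>2 * k / 2 + K * k" by (simp add: C_def algebra_simps)
    ultimately show ?thesis by linarith
  qed
  text \<open>Competitor: traverse the piece of the minimizer on the time interval from \<open>r\<close> to \<open>s\<close> at half
    the speed, which is possible by starting at time \<open>r - k\<close> and costs only half of the kinetic energy.\<close>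
  have slow: "u (X s) s - u (X r) (r - k) \<le> E r s / 4 + 2 * K * k"
  proof -
    define Y where "Y q = X (1 / 2 * q + s / 2)" for q
    define dY where "dY q = (1 / 2) *\<^sub>R dX (1 / 2 * q + s / 2)" for q
    have ends: "1 / 2 * (r - k) + s / 2 = r" "1 / 2 * s + s / 2 = s" "(r - k) / 2 + s / 2 = r"
      by (auto simp: k_def field_simps)
    have range: "1 / 2 * q + s / 2 \<in> {\<tau>..t}" if "q \<in> {r - k..s}" for q
      using that rs by (auto simp: k_def)
    \<comment> \<open>At half the speed the kinetic term of the Legendre upper bound has the factor
      1/8; the substitution doubles the integral, which gives \<open>E r s / 4\<close>, and the
      duration \<open>2 * k\<close> gives \<open>2 * K * k\<close>.\<close>
    have "((\<lambda>q. (norm (dX (1 / 2 * q + s / 2)))\<^sup>2) has_integral (E r s /\<^sub>R (1 / 2))) {r - k..s}"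
      using E_int[of r s] rs by (intro has_integral_affine_real) (auto simp: ends)
    then have "((\<lambda>q. (norm (dX (1 / 2 * q + s / 2)))\<^sup>2 / 8) has_integral (E r s /\<^sub>R (1 / 2) / 8)) {r - k..s}"
      by (rule has_integral_divide)
    moreover have "((\<lambda>q. K) has_integral (2 * K * k)) {r - k..s}"
      using has_integral_const_real[of K "r - k" s] rs by (simp add: k_def algebra_simps)
    ultimately have int: "((\<lambda>q. (norm (dX (1 / 2 * q + s / 2)))\<^sup>2 / 8 + K) has_integral
        (E r s /\<^sub>R (1 / 2) / 8 + 2 * K * k)) {r - k..s}"
      by (rule has_integral_add)
    have "u (Y s) s - u (Y (r - k)) (r - k)
        \<le> integral {r - k..s} (\<lambda>q. (norm (dX (1 / 2 * q + s / 2)))\<^sup>2 / 8 + K)"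
    proof (rule subsolution_along_curve[OF sub W cont])
      show "energy_curve Y dY (r - k) s"
        unfolding Y_def dY_def using X_sub[of r s] rs by (intro energy_curve_affine) (auto simp: ends)
      show "(\<lambda>q. (norm (dX (1 / 2 * q + s / 2)))\<^sup>2 / 8 + K) integrable_on {r - k..s}"
        using int by (auto simp: integrable_on_def)
      show "p \<bullet> dY q - h (Y q) p \<le> (norm (dX (1 / 2 * q + s / 2)))\<^sup>2 / 8 + K" for q p
        using legendre_upper[of p "dY q" "Y q"] by (simp add: dY_def power_mult_distrib power2_eq_square)
      show "Y q \<in> closure W" if "q \<in> {r - k..s}" for q
        unfolding Y_def by (rule X(2)[OF range[OF that]])
    qed (use k rs in auto)
    then show ?thesis using integral_unique[OF int] by (simp add: Y_def ends)
  qed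
  have "u (X s) s - u (X r) r = integral {r..s} \<Lambda>" using increment[of r s] rs by simp
  moreover have "E r s / 2 - K * k \<le> integral {r..s} \<Lambda>" using \<Lambda>_low[of r s] rs by (simp add: k_def)
  ultimately have "E r s / 4 \<le> 3 * (K * k) + C * k" using time_shift slow by linarith
  moreover define M where "M = sqrt (16 * K + 2 * G\<^sup>2)"
  moreover have M2: "M\<^sup>2 = 16 * K + 2 * G\<^sup>2" and "M > 0" using K by (auto simp: M_def add_pos_nonneg)
  moreover have "C * k = G\<^sup>2 * k / 2 + K * k" by (simp add: C_def algebra_simps)
  ultimately have "E r s \<le> M\<^sup>2 * k" by (simp add: algebra_simps)
  moreover have "2 * M * norm (X s - X r) \<le> E r s + M\<^sup>2 * (s - r)"
    unfolding E_def using X_sub[of r s] rs \<open>M > 0\<close> by (intro energy_curve_displacement) auto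
  ultimately have "2 * M * norm (X s - X r) \<le> 2 * M * (M * (s - r))"
    by (simp add: k_def power2_eq_square algebra_simps)
  then show ?thesis using \<open>M > 0\<close> by (simp add: M_def)
qed

end

section \<open>From minimizing curves to pointwise speed\<close>

lemma energy_curve_scaleR:
  assumes "energy_curve Y dY a b"
  shows "energy_curve (\<lambda>r. e *\<^sub>R Y r) (\<lambda>r. e *\<^sub>R dY r) a b"
  unfolding energy_curve_def
proof (intro conjI allI impI)
  show "((\<lambda>r. e *\<^sub>R dY r) has_integral (e *\<^sub>R Y s - e *\<^sub>R Y r)) {r..s}" if "a \<le> r \<and> r \<le> s \<and> s \<le> b" for r s
    using has_integral_cmul[OF energy_curveD(1)[OF assms, of r s], of e] that
    by (simp add: scaleR_diff_right)
  show "(\<lambda>r. (norm (e *\<^sub>R dY r))\<^sup>2) integrable_on {a..b}"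
    using assms by (auto simp: energy_curve_def power_mult_distrib intro: integrable_on_mult_right)
qed

text \<open>Finite cost gives finite energy: the cost dominates half the squared speed up to a
  constant. Measurability of the speed comes from integrability of \<open>dY\<close>, which the
  fundamental theorem supplies.\<close>

lemma AC_on_imp_energy_curve:
  fixes Y dY :: "real \<Rightarrow> 'a::euclidean_space"
  assumes AC: "AC_on {a..b} Y"
    and der: "AE s in lebesgue. s \<in> {a..b} \<longrightarrow> (Y has_vector_derivative dY s) (at s within {a..b})"
    and \<Lambda>: "\<Lambda> integrable_on {a..b}" "\<And>s. s \<in> {a..b} \<Longrightarrow> (norm (dY s))\<^sup>2 / 2 - K \<le> \<Lambda> s"
  shows "energy_curve Y dY a b"
proof -
  obtain N where N: "N \<in> null_sets lebesgue"
    and good: "\<And>s. s \<notin> N \<Longrightarrow> s \<in> {a..b} \<Longrightarrow> (Y has_vector_derivative dY s) (at s within {a..b})"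
    using der unfolding eventually_ae_filter by auto
  have "negligible N" using N by (simp add: negligible_iff_null_sets)
  have FTC: "(dY has_integral (Y s - Y r)) {r..s}" if "a \<le> r" "r \<le> s" "s \<le> b" for r s
  proof (rule AC_on_has_integral[OF AC_on_subset[OF AC] \<open>r \<le> s\<close> \<open>negligible N\<close>])
    show sub: "{r..s} \<subseteq> {a..b}" using that by auto
    show "(Y has_vector_derivative dY q) (at q within {r..s})" if "q \<in> {r..s} - N" for q
      using good[of q] that sub by (auto intro: has_vector_derivative_within_subset)
  qed
  show ?thesis
    unfolding energy_curve_def
  proof (intro conjI allI impI)
    show "(dY has_integral (Y s - Y r)) {r..s}" if "a \<le> r \<and> r \<le> s \<and> s \<le> b" for r s
      using FTC that by blast
    show "(\<lambda>r. (norm (dY r))\<^sup>2) integrable_on {a..b}"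
    proof (cases "a \<le> b")
      case True
      have "dY \<in> borel_measurable (lebesgue_on {a..b})"
        using FTC[of a b] True by (intro integrable_imp_measurable) (auto simp: integrable_on_def)
      then have "(\<lambda>r. (norm (dY r))\<^sup>2) \<in> borel_measurable (lebesgue_on {a..b})" by measurable
      moreover have "(\<lambda>r. 2 * (\<Lambda> r + K)) integrable_on {a..b}"
        using \<Lambda>(1) by (intro integrable_on_mult_right integrable_add) auto
      moreover have "norm ((norm (dY r))\<^sup>2) \<le> 2 * (\<Lambda> r + K)" if "r \<in> {a..b}" for r
        using \<Lambda>(2)[OF that] by simp
      ultimately show ?thesis
        by (rule measurable_bounded_by_integrable_imp_integrable) auto
    qed (simp add: integrable_on_empty)
  qed
qed

text \<open>Forward increments determine the derivative at a point before the right endpoint, and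
  only increments over short forward windows are controlled for a minimizer.\<close>

lemma norm_vector_derivative_le:
  fixes f :: "real \<Rightarrow> 'a::real_normed_vector"
  assumes der: "(f has_vector_derivative f') (at x within {a..b})" and x: "a \<le> x" "x < b" and "d > 0"
    and le: "\<And>y. x < y \<Longrightarrow> y < x + d \<Longrightarrow> y \<le> b \<Longrightarrow> norm (f y - f x) \<le> M * (y - x)"
  shows "norm f' \<le> M"
proof (rule field_le_epsilon)
  fix e :: real assume "e > 0"
  then obtain d' where "d' > 0"
    and d': "\<And>y. y \<in> {a..b} \<Longrightarrow> norm (y - x) < d' \<Longrightarrow> norm (f y - f x - (y - x) *\<^sub>R f') \<le> e * norm (y - x)"
    using der unfolding has_vector_derivative_def has_derivative_within_alt by blast
  define y where "y = x + min (min d d') (b - x) / 2"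
  have y: "x < y" "y < x + d" "y - x < d'" "y \<le> b"
    using x \<open>d > 0\<close> \<open>d' > 0\<close> by (auto simp: y_def min_def field_simps)
  have "norm ((y - x) *\<^sub>R f') \<le> norm (f y - f x) + norm (f y - f x - (y - x) *\<^sub>R f')"
    using norm_triangle_ineq4[of "f y - f x" "f y - f x - (y - x) *\<^sub>R f'"] by simp
  also have "\<dots> \<le> M * (y - x) + e * norm (y - x)"
    using y x by (intro add_mono le d') auto
  finally have "(y - x) * norm f' \<le> M * (y - x) + e * (y - x)"
    using y by simp
  then have "(y - x) * norm f' \<le> (y - x) * (M + e)"
    by (simp add: distrib_left mult.commute)
  then show "norm f' \<le> M + e" using y by simp
qed

text \<open>Quadratic growth bounds the family above, so the conditionally complete supremum really
  is an upper bound.\<close>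

lemma (in quadratic_hamiltonian) legendre_le_SUP:
  "p \<bullet> v - h y p \<le> (SUP q. q \<bullet> v - h y q)"
  by (rule cSUP_upper2[of _ _ p]) (auto intro: bdd_aboveI2 legendre_upper)

theorem lemma2p7:
  fixes H :: "real^'n \<Rightarrow> real^'n \<Rightarrow> real" and G :: real
  assumes "CARD('n) \<ge> 2"
    and "admissible_hamiltonian H"
  shows "\<exists>M0>0. \<forall>(\<Omega> :: (real^'n) set) (b :: real^'n \<Rightarrow> real^'n \<Rightarrow> real) (g :: real^'n \<Rightarrow> real).
    periodic_C1_domain \<Omega> \<and> admissible_bdry_data \<Omega> b \<and> admissible_initial_data \<Omega> b g \<and>
    gradient_Linfty_norm g G \<longrightarrow>
    (\<forall>(\<epsilon> :: real) (t :: real) (x :: real^'n) (u :: real^'n \<Rightarrow> real \<Rightarrow> real) (\<tau> :: real)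
       (\<gamma> :: real \<Rightarrow> real^'n) (d\<gamma> :: real \<Rightarrow> real^'n).
       0 < \<epsilon> \<and> 0 < t \<and> x \<in> closure (scaled_domain \<Omega> \<epsilon>) \<and>
       the_dirichlet_viscosity_solution H b g \<Omega> \<epsilon> u \<and>
       0 \<le> \<tau> \<and> \<tau> < t \<and> minimizing_curve H b g \<Omega> \<epsilon> u x t \<tau> \<gamma> d\<gamma> \<longrightarrow>
       (AE s in lebesgue. s \<in> {\<tau> / \<epsilon> .. t / \<epsilon>} \<longrightarrow> norm (d\<gamma> s) \<le> M0))"
proof -
  obtain K where "K > 0" and K: "\<And>y p. (norm p)\<^sup>2 / 2 - K \<le> H y p" "\<And>y p. H y p \<le> (norm p)\<^sup>2 / 2 + K"
    using assms(2) unfolding admissible_hamiltonian_def by meson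
  have H_cont: "continuous_on UNIV (\<lambda>(y, p). H y p)"
    using assms(2) unfolding admissible_hamiltonian_def by blast
  interpret H: quadratic_hamiltonian H K by standard (fact H_cont K)+
  \<comment> \<open>Fixed before the domain, the data and \<open>\<epsilon>\<close> are introduced;
    \<open>K\<close> is obtained from \<open>H\<close> alone.\<close>
  define M0 where "M0 = sqrt (16 * K + 2 * G\<^sup>2)"
  have "M0 > 0" using \<open>K > 0\<close> by (simp add: M0_def add_pos_nonneg)
  show ?thesis
  proof (intro exI[of _ M0] conjI \<open>M0 > 0\<close> allI impI, elim conjE)
    fix \<Omega> b g \<epsilon> t x u \<tau> \<gamma> d\<gamma>
    assume \<Omega>: "periodic_C1_domain \<Omega>" and b: "admissible_bdry_data \<Omega> b"
      and g: "admissible_initial_data \<Omega> b g" and Dg: "gradient_Linfty_norm g G"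
      and \<epsilon>: "(0::real) < \<epsilon>" and "0 < t"
      and u: "the_dirichlet_viscosity_solution H b g \<Omega> \<epsilon> u" and \<tau>: "0 \<le> \<tau>" "\<tau> < t"
      and min: "minimizing_curve H b g \<Omega> \<epsilon> u x t \<tau> \<gamma> d\<gamma>"
    define W where "W = scaled_domain \<Omega> \<epsilon>"
    define h where "h = (\<lambda>x. H (x /\<^sub>R \<epsilon>))"
    define I where "I = {\<tau> / \<epsilon>..t / \<epsilon>}"
    \<comment> \<open>The growth bounds hold uniformly in the space variable, so rescaling that
      variable keeps the same \<open>K\<close>.\<close>
    interpret quadratic_hamiltonian h K
    proof
      have "continuous_on UNIV ((\<lambda>(y, p). H y p) \<circ> (\<lambda>w. (fst w /\<^sub>R \<epsilon>, snd w)))"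
        by (intro continuous_on_compose continuous_on_subset[OF H_cont] continuous_intros) auto
      then show "continuous_on UNIV (\<lambda>(y, p). h y p)" by (simp add: o_def split_def h_def)
    qed (auto simp: h_def K)
    have "open \<Omega>" "C1_boundary \<Omega>" using \<Omega> by (auto simp: periodic_C1_domain_def)
    have "open W" unfolding W_def by (rule open_scaled_domain[OF \<epsilon> \<open>open \<Omega>\<close>])
    have W_C1: "locally_C1_superlevel W"
      unfolding W_def
      by (intro locally_C1_superlevel_scaled_domain C1_boundary_imp_locally_C1_superlevel) fact+
    have pushable: "inward_pushable W"
      by (rule locally_C1_superlevel_imp_inward_pushable[OF \<open>open W\<close> W_C1])
    have visc: "viscosity_subsolution H b \<Omega> \<epsilon> u"
      and u_cont: "continuous_on (closure W \<times> {0..}) (\<lambda>(x, t). u x t)"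
      and u_init: "\<And>x. x \<in> closure W \<Longrightarrow> u x 0 = g x"
      using u uniformly_continuous_imp_continuous
      unfolding the_dirichlet_viscosity_solution_def dirichlet_viscosity_solution_def W_def by blast+
    have sub: "interior_subsolution h W u"
      unfolding h_def W_def by (rule viscosity_subsolution_imp_interior[OF \<epsilon> visc])
    have b_cont: "continuous_on (UNIV \<times> frontier \<Omega>) (\<lambda>(x, y). b x y)"
      using b unfolding admissible_bdry_data_def BUC_on_def
      by (blast intro: uniformly_continuous_imp_continuous)
    have u_le_b: "u y r \<le> b y (y /\<^sub>R \<epsilon>)" if "y \<in> frontier W" "r > 0" for y r
      using that u_cont W_C1 quadratic_hamiltonian_axioms visc unfolding W_def h_def
      by (intro viscosity_subsolution_le_bdry_data[OF \<epsilon> \<open>open \<Omega>\<close> _ _ _ _ b_cont]) auto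
    have g_lip: "\<bar>g y - g z\<bar> \<le> G * norm (y - z)" for y z
      using g gradient_Linfty_norm_imp_lipschitz[OF _ Dg] unfolding admissible_initial_data_def by blast
    have \<gamma>: "\<And>s. s \<in> I \<Longrightarrow> \<gamma> s \<in> closure \<Omega>" "AC_on I \<gamma>"
      "AE s in lebesgue. s \<in> I \<longrightarrow> (\<gamma> has_vector_derivative d\<gamma> s) (at s within I)"
      "set_integrable lebesgue I (\<lambda>s. lagrangian H (\<gamma> s) (d\<gamma> s))"
      "u x t = \<epsilon> * (LINT s:I|lebesgue. lagrangian H (\<gamma> s) (d\<gamma> s))
        + bdry_initial_data b g \<epsilon> (\<epsilon> *\<^sub>R \<gamma> (\<tau> / \<epsilon>)) \<tau>"
      "\<gamma> (t / \<epsilon>) = x /\<^sub>R \<epsilon>" "(\<gamma> (\<tau> / \<epsilon>), \<tau>) \<in> parabolic_bdry \<Omega> t"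
      using min unfolding minimizing_curve_def Let_def I_def by blast+
    define \<Lambda> where "\<Lambda> s = lagrangian H (\<gamma> s) (d\<gamma> s)" for s
    have \<Lambda>_ge: "p \<bullet> d\<gamma> s - H (\<gamma> s) p \<le> \<Lambda> s" for p s
      unfolding \<Lambda>_def lagrangian_def by (rule H.legendre_le_SUP)
    have \<Lambda>: "\<Lambda> integrable_on I" "(LINT s:I|lebesgue. lagrangian H (\<gamma> s) (d\<gamma> s)) = integral I \<Lambda>"
      using set_lebesgue_integral_eq_integral[OF \<gamma>(4)] unfolding \<Lambda>_def by auto
    have curve: "energy_curve \<gamma> d\<gamma> (\<tau> / \<epsilon>) (t / \<epsilon>)"
      using \<gamma>(2,3) \<Lambda>(1) unfolding I_def
      by (rule AC_on_imp_energy_curve[where K = K]) (rule H.legendre_lower[OF \<Lambda>_ge])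
    \<comment> \<open>Space and time are scaled by the same factor, so velocities are unchanged, as
      \<open>dX_eq\<close> records. The summand 0 matches the affine substitution lemmas.\<close>
    define X where "X r = \<epsilon> *\<^sub>R \<gamma> (1 / \<epsilon> * r + 0)" for r
    define dX where "dX r = \<epsilon> *\<^sub>R (1 / \<epsilon>) *\<^sub>R d\<gamma> (1 / \<epsilon> * r + 0)" for r
    have X: "energy_curve X dX \<tau> t"
      unfolding X_def dX_def using curve \<epsilon> by (intro energy_curve_scaleR energy_curve_affine) auto
    have dX_eq: "dX r = d\<gamma> (1 / \<epsilon> * r + 0)" for r using \<epsilon> by (simp add: dX_def)
    have in_I: "1 / \<epsilon> * r + 0 \<in> I" if "r \<in> {\<tau>..t}" for r
      using that \<epsilon> by (auto simp: I_def divide_right_mono)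
    have X_cl: "X r \<in> closure W" if "r \<in> {\<tau>..t}" for r
      unfolding W_def using \<gamma>(1)[OF in_I[OF that]] \<epsilon> by (simp add: mem_closure_scaled_domain X_def)
    have int: "((\<lambda>r. \<Lambda> (1 / \<epsilon> * r + 0)) has_integral (\<epsilon> * integral I \<Lambda>)) {\<tau>..t}"
      using has_integral_affine_real[of \<Lambda> "integral I \<Lambda>" "1 / \<epsilon>" \<tau> 0 t] integrable_integral[OF \<Lambda>(1)] \<epsilon>
      by (simp add: I_def)
    define F where "F = bdry_initial_data b g \<epsilon> (X \<tau>) \<tau>"
    have "X t = x" using \<gamma>(6) \<epsilon> by (simp add: X_def)
    have X_lip: "norm (X s - X r) \<le> M0 * (s - r)"
      if "\<tau> < r" "r < s" "s \<le> t" "0 < \<tau> \<Longrightarrow> s - r < \<tau>" "s - r \<le> r" for r s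
      unfolding M0_def
    proof (rule minimizer_displacement[OF sub \<open>open W\<close> pushable u_cont \<tau> X X_cl _ _ _ _ _ _ \<open>K > 0\<close> that])
      show "(\<lambda>r. \<Lambda> (1 / \<epsilon> * r + 0)) integrable_on {\<tau>..t}" using int by (auto simp: integrable_on_def)
      show "p \<bullet> dX r - h (X r) p \<le> \<Lambda> (1 / \<epsilon> * r + 0)" for r p
        using \<Lambda>_ge[of p "1 / \<epsilon> * r + 0"] \<epsilon> by (simp add: dX_eq h_def X_def)
      show "u (X t) t = integral {\<tau>..t} (\<lambda>r. \<Lambda> (1 / \<epsilon> * r + 0)) + F"
        using \<gamma>(5) unfolding integral_unique[OF int] \<open>X t = x\<close> \<Lambda>(2) F_def by (simp add: X_def)
      \<comment> \<open>A positive \<open>r\<close> below \<open>\<tau>\<close> excludes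
        \<open>\<tau> = 0\<close>, so the starting point is on the lateral boundary; the datum
        \<open>b\<close> there is the same at every time \<open>r\<close>.\<close>
      show "u (X \<tau>) r \<le> F" if "0 < r" "r \<le> \<tau>" for r
      proof -
        have "\<gamma> (\<tau> / \<epsilon>) \<in> frontier \<Omega>" using \<gamma>(7) that by (auto simp: parabolic_bdry_def)
        then have "X \<tau> \<in> frontier W"
          unfolding W_def using \<epsilon> \<open>open \<Omega>\<close> by (simp add: mem_frontier_scaled_domain X_def)
        then show ?thesis using u_le_b that by (simp add: F_def bdry_initial_data_def)
      qed
      show "u (X 0) 0 = F" if "\<tau> = 0"
        using u_init[of "X 0"] X_cl[of 0] \<tau> that by (simp add: F_def bdry_initial_data_def)
      show "u y 0 - u (X 0) 0 \<le> G * norm (y - X 0)" if "\<tau> = 0" "y \<in> closure W" for y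
        using u_init[of "X 0"] u_init[of y] X_cl[of 0] \<tau> that g_lip[of y "X 0"] by simp
    qed
    have bound: "norm (d\<gamma> s) \<le> M0"
      if s: "\<tau> / \<epsilon> < s" "s < t / \<epsilon>" and der: "(\<gamma> has_vector_derivative d\<gamma> s) (at s within I)" for s
    proof (rule norm_vector_derivative_le)
      show "(\<gamma> has_vector_derivative d\<gamma> s) (at s within {\<tau> / \<epsilon>..t / \<epsilon>})" using der by (simp add: I_def)
      have "\<tau> < \<epsilon> * s" using s \<epsilon> by (simp add: field_simps)
      \<comment> \<open>Admissible forward window: the bound \<open>s\<close> keeps the shifted time
        nonnegative, and for positive \<open>\<tau>\<close> the bound
        \<open>\<tau> / \<epsilon>\<close> keeps the shifted starting time positive.\<close>
      show "0 < (if \<tau> = 0 then s else min s (\<tau> / \<epsilon>))" using \<tau> \<epsilon> s by (auto simp: le_less_trans)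
      fix y assume y: "s < y" "y < s + (if \<tau> = 0 then s else min s (\<tau> / \<epsilon>))" "y \<le> t / \<epsilon>"
      have "norm (X (\<epsilon> * y) - X (\<epsilon> * s)) \<le> M0 * (\<epsilon> * y - \<epsilon> * s)"
      proof (rule X_lip)
        show "\<epsilon> * s < \<epsilon> * y" "\<epsilon> * y \<le> t" using y \<epsilon> by (auto simp: field_simps)
        show "\<epsilon> * y - \<epsilon> * s < \<tau>" if "0 < \<tau>"
        proof -
          have "\<epsilon> * (y - s) < \<epsilon> * (\<tau> / \<epsilon>)" using y that \<epsilon> by (intro mult_strict_left_mono) auto
          then show ?thesis using \<epsilon> by (simp add: right_diff_distrib)
        qed
        have "y - s \<le> s" using y by (auto split: if_splits)
        then have "\<epsilon> * (y - s) \<le> \<epsilon> * s" using \<epsilon> by (intro mult_left_mono) auto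
        then show "\<epsilon> * y - \<epsilon> * s \<le> \<epsilon> * s" by (simp add: algebra_simps)
      qed fact
      moreover have "norm (X (\<epsilon> * y) - X (\<epsilon> * s)) = \<epsilon> * norm (\<gamma> y - \<gamma> s)"
        using \<epsilon> by (simp add: X_def scaleR_diff_right[symmetric])
      ultimately have "\<epsilon> * norm (\<gamma> y - \<gamma> s) \<le> \<epsilon> * (M0 * (y - s))" by (simp add: algebra_simps)
      then show "norm (\<gamma> y - \<gamma> s) \<le> M0 * (y - s)" using \<epsilon> by simp
    qed (use s in auto)
    \<comment> \<open>The endpoints form a null set and are discarded: \<open>X_lip\<close> requires
      times after \<open>\<tau>\<close>, and the forward quotient requires times before the
      end.\<close>
    have "AE s in lebesgue. s \<noteq> \<tau> / \<epsilon>" "AE s in lebesgue. s \<noteq> t / \<epsilon>"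
      by (simp_all add: AE_completion_iff AE_lborel_singleton)
    with \<gamma>(3) show "AE s in lebesgue. s \<in> {\<tau> / \<epsilon>..t / \<epsilon>} \<longrightarrow> norm (d\<gamma> s) \<le> M0"
    proof eventually_elim
      case (elim s)
      then show ?case using bound[of s] by (auto simp: I_def)
    qed
  qed
qed

end
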